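(* Let $G$ be a connected graph of order $n \ge 8$. Then $\gamma_t^d(G) \le 2(n-1)/3$, with equality if and only if $G \in \mathcal{T} \cup \mathcal{F} \cup \mathcal{G}$.
   Context: All graphs are finite and simple. For a graph $G$ with no isolated vertex, a set $S \subseteq V(G)$ is a disjunctive total dominating set (DTD-set) of $G$ if every vertex of $G$ (including those in $S$) either is adjacent to a vertex of $S$ or has at least two vertices of $S$ at distance exactly $2$ from it. The disjunctive total domination number $\gamma_t^d(G)$ is the minimum cardinality of a DTD-set of $G$. For $k \ge 1$, $T_k$ is the tree obtained from the star $K_{1,k}$ by subdividing every edge exactly twice (so $T_1 = P_4$), and $\mathcal{T} = \{T_k : k \ge 1\}$. For $k \ge 2$, $G_k$ is the graph obtained from $T_k$ by adding an edge joining two neighbors of the central vertex of $T_k$, and $\mathcal{G} = \{G_k : k \ge 2\}$. For $k \ge 2$, $F_k$ is the tree obtained from $T_k$ by deleting an edge $uv$ incident with the central vertex $v$ of $T_k$ and adding the edge $uw$ for some neighbor $w$ of $v$ different from $u$, and $\mathcal{F} = \{F_k : k \ge 2\}$. *)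

theory Defs
  imports Complex_Main "Graph_Theory.Graph_Theory"
begin

text \<open>
  A finite simple graph is a \<open>pair_graph\<close>: a finite, loopless, symmetric relation on a finite
  vertex set, so that an undirected edge \<open>uv\<close> is the pair of arcs \<open>(u, v)\<close> and \<open>(v, u)\<close>.
\<close>

definition graph_dist :: "'a pair_pre_digraph \<Rightarrow> 'a \<Rightarrow> 'a \<Rightarrow> ereal" where
  "graph_dist G u v = wf_digraph.\<mu> (with_proj G) (\<lambda>_. 1) u v"

definition dtd_set :: "'a pair_pre_digraph \<Rightarrow> 'a set \<Rightarrow> bool" where
  "dtd_set G S \<longleftrightarrow> S \<subseteq> pverts G \<and>
     (\<forall>v \<in> pverts G. (\<exists>s \<in> S. (v, s) \<in> parcs G) \<or> 2 \<le> card {s \<in> S. graph_dist G v s = 2})"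

text \<open>
  Meaningful only for finite graphs without isolated vertices; for these the whole vertex set
  is a DTD-set, so the minimum below is attained.
\<close>

definition dtd_number :: "'a pair_pre_digraph \<Rightarrow> nat" where
  "dtd_number G = (LEAST m. \<exists>S. dtd_set G S \<and> card S = m)"

definition add_edge :: "'a pair_pre_digraph \<Rightarrow> 'a \<Rightarrow> 'a \<Rightarrow> 'a pair_pre_digraph" where
  "add_edge G u v = \<lparr>pverts = pverts G, parcs = parcs G \<union> {(u, v), (v, u)}\<rparr>"

definition del_edge :: "'a pair_pre_digraph \<Rightarrow> 'a \<Rightarrow> 'a \<Rightarrow> 'a pair_pre_digraph" where
  "del_edge G u v = \<lparr>pverts = pverts G, parcs = parcs G - {(u, v), (v, u)}\<rparr>"

definition T_center :: "nat \<times> nat" where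
  "T_center = (0, 0)"

text \<open>
  In \<open>T_graph k\<close> the leaves of the star with \<open>k\<close> edges are the vertices \<open>(i, 3)\<close> for
  \<open>1 \<le> i \<le> k\<close>; the edge from the center to \<open>(i, 3)\<close> is subdivided by \<open>(i, 1)\<close> and \<open>(i, 2)\<close>.
\<close>

definition T_arcs :: "nat \<Rightarrow> (nat \<times> nat) rel" where
  "T_arcs k = {(T_center, (i, 1)) | i. i \<in> {1..k}}
            \<union> {((i, 1), (i, 2)) | i. i \<in> {1..k}}
            \<union> {((i, 2), (i, 3)) | i. i \<in> {1..k}}"

definition T_graph :: "nat \<Rightarrow> (nat \<times> nat) pair_pre_digraph" where
  "T_graph k = \<lparr>pverts = insert T_center ({1..k} \<times> {1..3}), parcs = T_arcs k \<union> (T_arcs k)\<inverse>\<rparr>"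

text \<open>The families are closed under isomorphism.\<close>

definition family_T :: "'a pair_pre_digraph set" where
  "family_T = {G. \<exists>k \<ge> 1. digraph_iso (with_proj G) (with_proj (T_graph k))}"

definition family_G :: "'a pair_pre_digraph set" where
  "family_G = {G. \<exists>k \<ge> 2. \<exists>u w. u \<noteq> w \<and>
     (T_center, u) \<in> parcs (T_graph k) \<and> (T_center, w) \<in> parcs (T_graph k) \<and>
     digraph_iso (with_proj G) (with_proj (add_edge (T_graph k) u w))}"

definition family_F :: "'a pair_pre_digraph set" where
  "family_F = {G. \<exists>k \<ge> 2. \<exists>u w. u \<noteq> w \<and>
     (T_center, u) \<in> parcs (T_graph k) \<and> (T_center, w) \<in> parcs (T_graph k) \<and>
     digraph_iso (with_proj G)
       (with_proj (add_edge (del_edge (T_graph k) u T_center) u w))}"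

end

theory Submission
  imports Defs
begin

text \<open>
  Adding edges never destroys a disjunctive total dominating set, so the upper bound reduces to a
  spanning tree. A tree is reduced at a vertex of maximal depth: removing one of two leaves with a
  common neighbour costs nothing, removing a pendant path with two vertices next to a leaf or to
  another such path costs one vertex of the set, and removing a pendant path with three vertices
  costs two. Only the last step can preserve equality. By induction every tree is small, satisfies
  the strict bound, or has legs: a connected hub \<open>c, a\<^sub>1, \<dots>, a\<^sub>k\<close> with a pendant
  path \<open>b\<^sub>i l\<^sub>i\<close> at every \<open>a\<^sub>i\<close>. In a graph with legs and \<open>k \<ge> 3\<close>, the set of all
  \<open>a\<^sub>i, b\<^sub>i\<close> has \<open>2k = 2(n - 1)/3\<close> elements. A vertex can be saved as soon as an edge outside
  the legs meets some \<open>b\<^sub>i\<close> or \<open>l\<^sub>i\<close>, or the hub is not a star with center \<open>c\<close> in which at most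
  one edge \<open>a\<^sub>u a\<^sub>w\<close> was added or replaces \<open>c a\<^sub>u\<close>. Conversely, in the three families every
  dominating set contains all \<open>b\<^sub>i\<close> and, for each leg, one more vertex of its own.
\<close>

text \<open>All bounds are compared as \<open>3 * card S + 2\<close> against
  \<open>2 * card V\<close>. A leaf gained for nothing wins 2, a path of two vertices for one vertex
  of the set wins 1, a path of three for two wins 0. Hence the last step has to carry structure
  along and not only an inequality. It may attach its path at any vertex of the hub, which is why
  the hub is merely connected and not yet a star; which hubs really attain equality is decided once,
  for the whole graph and not for the tree. The bound fails for the paths with 1, 2, 3, 5 and 6
  vertices, so the induction cannot rest on an inequality alone: the extensions of these trees, and
  of the three small trees with equality but without two legs, are settled by checked certificates.
  These eight trees have at most 7 vertices, and so has a graph with exactly two legs. This is where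
  order 8 enters, and why a third leg is always at hand in the final analysis.\<close>

section \<open>Disjunctive total domination as a monotone property\<close>

text \<open>
  Requiring only a walk of length 2 instead of distance exactly 2 makes the notion monotone in
  the edge set: if the walk can be shortened, then the vertex is adjacent to the set anyway.
\<close>

definition served :: "'a rel \<Rightarrow> 'a set \<Rightarrow> 'a \<Rightarrow> bool" where
  "served E S v \<longleftrightarrow> (\<exists>s\<in>S. (v, s) \<in> E) \<or>
     (\<exists>s\<in>S. \<exists>t\<in>S. s \<noteq> t \<and> s \<noteq> v \<and> t \<noteq> v \<and> (v, s) \<in> E O E \<and> (v, t) \<in> E O E)"

definition dom_set :: "'a set \<Rightarrow> 'a rel \<Rightarrow> 'a set \<Rightarrow> bool" where
  "dom_set V E S \<longleftrightarrow> S \<subseteq> V \<and> (\<forall>v\<in>V. served E S v)"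

lemma served_adjI: "(v, s) \<in> E \<Longrightarrow> s \<in> S \<Longrightarrow> served E S v"
  unfolding served_def by blast

lemma served_twoI:
  "(v, x) \<in> E \<Longrightarrow> (x, s) \<in> E \<Longrightarrow> (v, y) \<in> E \<Longrightarrow> (y, t) \<in> E \<Longrightarrow> s \<in> S \<Longrightarrow> t \<in> S \<Longrightarrow>
    s \<noteq> t \<Longrightarrow> s \<noteq> v \<Longrightarrow> t \<noteq> v \<Longrightarrow> served E S v"
  unfolding served_def by blast

lemma served_mono: "served E S v \<Longrightarrow> E \<subseteq> E' \<Longrightarrow> S \<subseteq> S' \<Longrightarrow> served E' S' v"
  unfolding served_def by (meson relcomp_mono subsetD)

context pair_graph
begin

lemma awalk_cost_one: "awalk_cost (\<lambda>_. 1) p = real (length p)"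
  by (induct p) (auto simp: awalk_cost_def)

text \<open>Distance is an infimum of walk lengths in \<open>ereal\<close>; the value 2 means that
  walks of length 0 and 1 are impossible while one of length 2 exists.\<close>

lemma graph_dist_eq_2_iff:
  assumes "v \<in> pverts G"
  shows "graph_dist G v s = 2 \<longleftrightarrow> v \<noteq> s \<and> (v, s) \<notin> parcs G \<and> (v, s) \<in> parcs G O parcs G"
proof -
  have dist: "graph_dist G v s = (INF p\<in>{p. awalk v p s}. ereal (real (length p)))"
    unfolding graph_dist_def \<mu>_def by (simp add: awalk_cost_one)
  have walk0: "awalk v [] s \<longleftrightarrow> v = s"
    using assms by (auto simp: awalk_Nil_iff)
  have walk1: "awalk v [e] s \<longleftrightarrow> e = (v, s) \<and> e \<in> parcs G" for e
    by (cases e) (auto simp: awalk_Cons_iff awalk_Nil_iff dest: wellformed')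
  have walk2: "awalk v [e, e'] s \<longleftrightarrow> (\<exists>x. e = (v, x) \<and> e' = (x, s) \<and> e \<in> parcs G \<and> e' \<in> parcs G)"
    for e e'
    by (cases e; cases e') (auto simp: awalk_Cons_iff awalk_Nil_iff dest: wellformed')
  show ?thesis
  proof
    assume 2: "graph_dist G v s = 2"
    have lower: "2 \<le> length p" if "awalk v p s" for p
    proof -
      have "graph_dist G v s \<le> ereal (real (length p))"
        unfolding dist using that by (auto intro: INF_lower)
      then have "ereal 2 \<le> ereal (real (length p))" unfolding 2 by simp
      then show ?thesis by simp
    qed
    \<comment> \<open>An infimum below 3 is undercut by an actual walk; lengths are natural numbers,
      so \<open>lower\<close> leaves only length 2.\<close>
    have "graph_dist G v s < ereal 3" unfolding 2 by simp
    then obtain p where p: "awalk v p s" "real (length p) < 3"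
      unfolding dist by (auto simp: INF_less_iff)
    then have "length p = 2" using lower[of p] by linarith
    then obtain e e' where "p = [e, e']"
      by (auto simp: numeral_2_eq_2 length_Suc_conv)
    with p(1) walk2[of e e'] have "(v, s) \<in> parcs G O parcs G" by auto
    moreover have "v \<noteq> s" using lower[of "[]"] walk0 by auto
    moreover have "(v, s) \<notin> parcs G" using lower[of "[(v, s)]"] walk1 by auto
    ultimately show "v \<noteq> s \<and> (v, s) \<notin> parcs G \<and> (v, s) \<in> parcs G O parcs G" by blast
  next
    assume A: "v \<noteq> s \<and> (v, s) \<notin> parcs G \<and> (v, s) \<in> parcs G O parcs G"
    then obtain x where "(v, x) \<in> parcs G" "(x, s) \<in> parcs G" by blast
    then have "awalk v [(v, x), (x, s)] s" using walk2[of "(v, x)" "(x, s)"] by simp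
    then have "graph_dist G v s \<le> ereal (real (length [(v, x), (x, s)]))"
      unfolding dist by (intro INF_lower) simp
    moreover have "ereal 2 \<le> graph_dist G v s"
      unfolding dist
    proof (rule INF_greatest)
      fix p assume "p \<in> {p. awalk v p s}"
      then have p: "awalk v p s" by simp
      have "2 \<le> length p"
      proof (rule ccontr)
        assume "\<not> 2 \<le> length p"
        then consider "p = []" | e where "p = [e]"
          by (cases p) (auto simp: not_le less_Suc_eq numeral_2_eq_2)
        then show False using p A walk0 walk1 by cases auto
      qed
      then show "ereal 2 \<le> ereal (real (length p))" by simp
    qed
    ultimately show "graph_dist G v s = 2" by (simp add: antisym)
  qed
qed

lemma dtd_set_iff_dom_set: "dtd_set G S \<longleftrightarrow> dom_set (pverts G) (parcs G) S"
proof -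
  have "(\<exists>s\<in>S. (v, s) \<in> parcs G) \<or> 2 \<le> card {s \<in> S. graph_dist G v s = 2}
      \<longleftrightarrow> served (parcs G) S v" if S: "S \<subseteq> pverts G" and v: "v \<in> pverts G" for v
  proof (cases "\<exists>s\<in>S. (v, s) \<in> parcs G")
    case True
    then show ?thesis by (auto simp: served_def)
  next
    case False
    let ?D = "{s \<in> S. graph_dist G v s = 2}"
    have D: "?D = {s \<in> S. s \<noteq> v \<and> (v, s) \<in> parcs G O parcs G}"
      using False graph_dist_eq_2_iff[OF v] by blast
    have fin: "finite ?D" using finite_subset[OF S pair_finite_verts] by simp
    have "2 \<le> card ?D \<longleftrightarrow> \<not> card ?D \<le> Suc 0" by linarith
    also have "\<dots> \<longleftrightarrow> (\<exists>s\<in>?D. \<exists>t\<in>?D. s \<noteq> t)"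
      using card_le_Suc0_iff_eq[OF fin] by blast
    also have "\<dots> \<longleftrightarrow> served (parcs G) S v"
      using False unfolding D served_def by blast
    finally show ?thesis using False by blast
  qed
  then show ?thesis unfolding dtd_set_def dom_set_def by blast
qed

end

text \<open>The bound \<open>2(n - 1)/3\<close>, strict and non-strict, without division or subtraction.\<close>

definition dom_strict :: "'a set \<Rightarrow> 'a rel \<Rightarrow> bool" where
  "dom_strict V E \<longleftrightarrow> (\<exists>S. dom_set V E S \<and> 3 * card S + 2 < 2 * card V)"

definition dom_weak :: "'a set \<Rightarrow> 'a rel \<Rightarrow> bool" where
  "dom_weak V E \<longleftrightarrow> (\<exists>S. dom_set V E S \<and> 3 * card S + 2 \<le> 2 * card V)"

text \<open>
  The relation \<open>E\<close> may contain further edges: by monotonicity a spanning copy of \<open>R\<close> suffices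
  to transfer dominating sets.
\<close>

definition emb :: "('b \<Rightarrow> 'a) \<Rightarrow> 'b set \<Rightarrow> 'b rel \<Rightarrow> 'a set \<Rightarrow> 'a rel \<Rightarrow> bool" where
  "emb f W R V E \<longleftrightarrow> bij_betw f W V \<and> R \<subseteq> W \<times> W \<and> (\<forall>(x, y)\<in>R. (f x, f y) \<in> E)"

lemma dom_set_emb:
  assumes "emb f W R V E" "dom_set W R S"
  shows "dom_set V E (f ` S)" "card (f ` S) = card S" "card V = card W"
proof -
  have bij: "bij_betw f W V" and R: "R \<subseteq> W \<times> W" and RE: "\<And>x y. (x, y) \<in> R \<Longrightarrow> (f x, f y) \<in> E"
    using assms(1) by (auto simp: emb_def)
  have S: "S \<subseteq> W" using assms(2) by (simp add: dom_set_def)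
  have inj: "inj_on f W" and V: "V = f ` W" using bij by (auto simp: bij_betw_def)
  show "card (f ` S) = card S" using inj S by (meson card_image inj_on_subset)
  show "card V = card W" using bij by (simp add: bij_betw_same_card)
  have "served E (f ` S) (f w)" if w: "w \<in> W" for w
  proof -
    have "served R S w" using assms(2) w by (simp add: dom_set_def)
    then consider s where "s \<in> S" "(w, s) \<in> R"
      | s t x y where "s \<in> S" "t \<in> S" "s \<noteq> t" "s \<noteq> w" "t \<noteq> w" "(w, x) \<in> R" "(x, s) \<in> R"
          "(w, y) \<in> R" "(y, t) \<in> R"
      unfolding served_def by blast
    then show ?thesis
    proof cases
      case 1
      then show ?thesis using RE by (blast intro: served_adjI)
    next
      case 2
      have "f s \<noteq> f t" "f s \<noteq> f w" "f t \<noteq> f w"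
        using 2 S w inj by (metis inj_onD subsetD)+
      then show ?thesis using 2 RE by (blast intro: served_twoI)
    qed
  qed
  then show "dom_set V E (f ` S)" using S V by (auto simp: dom_set_def)
qed

lemma dom_strict_emb: "emb f W R V E \<Longrightarrow> dom_strict W R \<Longrightarrow> dom_strict V E"
  unfolding dom_strict_def by (metis dom_set_emb)

lemma dom_weak_emb: "emb f W R V E \<Longrightarrow> dom_weak W R \<Longrightarrow> dom_weak V E"
  unfolding dom_weak_def by (metis dom_set_emb)

lemma emb_comp:
  assumes "emb g U Q W R" "emb f W R V E"
  shows "emb (f \<circ> g) U Q V E"
  using assms unfolding emb_def by (auto intro: bij_betw_trans)

lemma dom_strict_imp_weak: "dom_strict V E \<Longrightarrow> dom_weak V E"
  unfolding dom_strict_def dom_weak_def by (meson less_imp_le)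

section \<open>Small trees\<close>

definition sym_edges :: "(nat \<times> nat) list \<Rightarrow> nat rel" where
  "sym_edges es = set es \<union> (set es)\<inverse>"

definition shape :: "'a set \<Rightarrow> 'a rel \<Rightarrow> nat \<times> (nat \<times> nat) list \<Rightarrow> bool" where
  "shape V E X \<longleftrightarrow> (\<exists>f. emb f {..<fst X} (sym_edges (snd X)) V E)"

lemma shape_trans:
  "emb g {..<m} (sym_edges es') {..<n} (sym_edges es) \<Longrightarrow> shape V E (n, es) \<Longrightarrow> shape V E (m, es')"
  unfolding shape_def by (auto intro: emb_comp)

text \<open>The new leaf gets the next free number \<open>n\<close>, so applying the operation again
  at \<open>fst X\<close> prolongs the path just started.\<close>

definition pendant_shape :: "nat \<Rightarrow> nat \<times> (nat \<times> nat) list \<Rightarrow> nat \<times> (nat \<times> nat) list" where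
  "pendant_shape i = (\<lambda>(n, es). (Suc n, (i, n) # es))"

lemma emb_pendant_shape:
  assumes "emb f {..<n} (sym_edges es) V E" "i < n" "x \<notin> V" "(f i, x) \<in> E'" "(x, f i) \<in> E'" "E \<subseteq> E'"
  shows "emb (f(n := x)) {..<Suc n} (sym_edges ((i, n) # es)) (insert x V) E'"
proof -
  have bij: "bij_betw f {..<n} V" and R: "sym_edges es \<subseteq> {..<n} \<times> {..<n}"
    and RE: "\<And>x y. (x, y) \<in> sym_edges es \<Longrightarrow> (f x, f y) \<in> E"
    using assms(1) by (auto simp: emb_def)
  have "bij_betw (f(n := x)) {..<n} V"
    using bij by (subst bij_betw_cong[of _ _ f]) auto
  then have "bij_betw (f(n := x)) (insert n {..<n}) (insert x V)"
    using assms(3) by (subst notIn_Un_bij_betw3[symmetric, of n _ "f(n := x)", simplified]) auto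
  moreover have "sym_edges ((i, n) # es) = sym_edges es \<union> {(i, n), (n, i)}"
    by (auto simp: sym_edges_def)
  ultimately show ?thesis
    unfolding emb_def lessThan_Suc using R RE assms by fastforce
qed

lemma shape_dom_strict:
  assumes "shape V E (n, es)"
    and "set S \<subseteq> {..<n}" "3 * length S + 2 < 2 * n" "\<forall>v<n. served (sym_edges es) (set S) v"
  shows "dom_strict V E"
proof -
  have "card (set S) \<le> length S" by (rule card_length)
  then have "dom_strict {..<n} (sym_edges es)"
    unfolding dom_strict_def dom_set_def
    using assms(2-4) by (intro exI[of _ "set S"]) auto
  then show ?thesis using assms(1) dom_strict_emb by (auto simp: shape_def)
qed

definition path_shape :: "nat \<Rightarrow> nat \<times> (nat \<times> nat) list" where
  "path_shape n = (n, map (\<lambda>i. (i, Suc i)) [0..<n - 1])"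

text \<open>
  The first five shapes are the only trees that violate the bound. The others attain it: the next
  three do not have two legs in the sense of \<open>legs\<close> below, the last two do.
\<close>

definition small_shapes :: "(nat \<times> (nat \<times> nat) list) list" where
  "small_shapes =
     [path_shape 1, path_shape 2, path_shape 3, path_shape 5, path_shape 6,
      (4, [(0, 1), (0, 2), (0, 3)]),
      pendant_shape 1 (path_shape 6),
      path_shape 4, path_shape 7, pendant_shape 2 (path_shape 6)]"

text \<open>
  Either a dominating set witnessing the strict bound, or the index of a small shape together
  with the images of its vertices.
\<close>

datatype cert = Dom "nat list" | Relabel nat "nat list"

fun nbrs :: "(nat \<times> nat) list \<Rightarrow> nat \<Rightarrow> nat list" where
  "nbrs [] v = []"
| "nbrs ((x, y) # es) v = (if x = v then [y] else []) @ (if y = v then [x] else []) @ nbrs es v"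

text \<open>\<open>D\<close> lists, with repetitions, the members of \<open>S\<close> other than
  \<open>v\<close> reached in two steps; it has two different entries exactly if some entry differs
  from its head.\<close>

definition served_code :: "(nat \<times> nat) list \<Rightarrow> nat list \<Rightarrow> nat \<Rightarrow> bool" where
  "served_code es S v \<longleftrightarrow> list_ex (\<lambda>x. x \<in> set S) (nbrs es v) \<or>
     (let D = filter (\<lambda>t. t \<noteq> v \<and> t \<in> set S) (concat (map (nbrs es) (nbrs es v)))
      in D \<noteq> [] \<and> list_ex (\<lambda>t. t \<noteq> hd D) D)"

fun valid_cert :: "nat \<times> (nat \<times> nat) list \<Rightarrow> cert \<Rightarrow> bool" where
  "valid_cert (n, es) (Dom S) \<longleftrightarrow> list_all (\<lambda>s. s < n) S \<and> 3 * length S + 2 < 2 * n \<and>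
     list_all (served_code es S) [0..<n]"
| "valid_cert (n, es) (Relabel t p) \<longleftrightarrow> t < length small_shapes \<and> fst (small_shapes ! t) = n \<and>
     length p = n \<and> distinct p \<and> list_all (\<lambda>s. s < n) p \<and>
     list_all (\<lambda>(x, y). x < n \<and> y < n \<and> p ! y \<in> set (nbrs es (p ! x))) (snd (small_shapes ! t))"

lemma set_nbrs: "set (nbrs es v) = {w. (v, w) \<in> sym_edges es}"
  by (induct es v rule: nbrs.induct) (auto simp: sym_edges_def)

lemma served_code_sound:
  assumes "served_code es S v"
  shows "served (sym_edges es) (set S) v"
  using assms unfolding served_code_def
proof
  assume "list_ex (\<lambda>x. x \<in> set S) (nbrs es v)"
  then show ?thesis by (auto simp: list_ex_iff set_nbrs served_def)
next
  define D where "D = filter (\<lambda>t. t \<noteq> v \<and> t \<in> set S) (concat (map (nbrs es) (nbrs es v)))"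
  have D: "set D = {t \<in> set S. t \<noteq> v \<and> (v, t) \<in> sym_edges es O sym_edges es}"
    unfolding D_def by (auto simp: set_nbrs)
  assume "let D = filter (\<lambda>t. t \<noteq> v \<and> t \<in> set S) (concat (map (nbrs es) (nbrs es v)))
      in D \<noteq> [] \<and> list_ex (\<lambda>t. t \<noteq> hd D) D"
  then have "D \<noteq> []" "list_ex (\<lambda>t. t \<noteq> hd D) D" unfolding D_def by (simp_all add: Let_def)
  then obtain t where "t \<in> set D" "hd D \<in> set D" "t \<noteq> hd D" by (auto simp: list_ex_iff)
  then show ?thesis unfolding D served_def by blast
qed

lemma valid_cert_sound:
  assumes "shape V E X" "valid_cert X ct"
  shows "(\<exists>Y\<in>set small_shapes. shape V E Y) \<or> dom_strict V E"
proof (cases ct)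
  case (Dom S)
  obtain n es where X: "X = (n, es)" by (cases X)
  have "dom_strict V E"
    using assms served_code_sound unfolding Dom X
    by (intro shape_dom_strict[of V E n es S]) (auto simp: list_all_iff)
  then show ?thesis ..
next
  case (Relabel t p)
  obtain n es where X: "X = (n, es)" by (cases X)
  obtain fs where T: "small_shapes ! t = (n, fs)" and t: "t < length small_shapes"
    using assms(2) unfolding Relabel X by (cases "small_shapes ! t") auto
  have p: "length p = n" "distinct p" "set p \<subseteq> {..<n}"
    and fs: "\<And>x y. (x, y) \<in> set fs \<Longrightarrow> x < n \<and> y < n \<and> (p ! x, p ! y) \<in> sym_edges es"
    using assms(2) unfolding Relabel X by (auto simp: T list_all_iff set_nbrs)
  have "set p = {..<n}"
    using p by (intro card_subset_eq) (auto simp: distinct_card)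
  then have "bij_betw ((!) p) {..<n} {..<n}"
    using bij_betw_nth[of p "{..<n}" "set p"] p by simp
  moreover have "(y, x) \<in> sym_edges es" if "(x, y) \<in> sym_edges es" for x y
    using that by (auto simp: sym_edges_def)
  ultimately have "emb ((!) p) {..<n} (sym_edges fs) {..<n} (sym_edges es)"
    using fs unfolding emb_def by (auto simp: sym_edges_def[of fs])
  then have "shape V E (small_shapes ! t)"
    using assms(1) shape_trans unfolding X T by blast
  then show ?thesis using t nth_mem by blast
qed

text \<open>
  Row \<open>t\<close>, column \<open>i\<close> certifies the result of attaching a path with one, two or three vertices
  to vertex \<open>i\<close> of small shape \<open>t\<close>; the certificates were found by exhaustive search.
\<close>

definition chain1_certs :: "cert list list" where
  "chain1_certs = [
     [Relabel 1 [0, 1]],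
     [Relabel 2 [1, 0, 2], Relabel 2 [0, 1, 2]],
     [Relabel 7 [2, 1, 0, 3], Relabel 5 [1, 0, 2, 3], Relabel 7 [0, 1, 2, 3]],
     [Relabel 4 [4, 3, 2, 1, 0, 5], Dom [1, 2, 3], Dom [1, 2, 3], Dom [1, 2, 3],
      Relabel 4 [0, 1, 2, 3, 4, 5]],
     [Relabel 8 [5, 4, 3, 2, 1, 0, 6], Relabel 6 [0, 1, 2, 3, 4, 5, 6],
      Relabel 9 [0, 1, 2, 3, 4, 5, 6], Relabel 9 [5, 4, 3, 2, 1, 0, 6],
      Relabel 6 [5, 4, 3, 2, 1, 0, 6], Relabel 8 [0, 1, 2, 3, 4, 5, 6]]]"

definition chain2_certs :: "cert list list" where
  "chain2_certs = [
     [Relabel 2 [0, 1, 2]],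
     [Relabel 7 [1, 0, 2, 3], Relabel 7 [0, 1, 2, 3]],
     [Relabel 3 [2, 1, 0, 3, 4], Dom [1, 3], Relabel 3 [0, 1, 2, 3, 4]],
     [Relabel 8 [4, 3, 2, 1, 0, 5, 6], Relabel 9 [6, 5, 1, 2, 3, 4, 0], Dom [1, 3, 5],
      Relabel 9 [6, 5, 3, 2, 1, 0, 4], Relabel 8 [0, 1, 2, 3, 4, 5, 6]],
     [Dom [0, 3, 4, 6], Dom [1, 3, 4, 6], Dom [1, 3, 4, 6], Dom [1, 2, 4, 6], Dom [0, 1, 4, 6],
      Dom [0, 1, 5, 6]]]"

definition chain3_certs :: "cert list list" where
  "chain3_certs = [
     [Relabel 7 [0, 1, 2, 3]],
     [Relabel 3 [1, 0, 2, 3, 4], Relabel 3 [0, 1, 2, 3, 4]],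
     [Relabel 4 [2, 1, 0, 3, 4, 5], Dom [1, 3, 4], Relabel 4 [0, 1, 2, 3, 4, 5]],
     [Dom [2, 3, 5, 6], Dom [2, 3, 5, 6], Dom [1, 3, 5, 6], Dom [1, 2, 5, 6], Dom [0, 1, 5, 6]],
     [Dom [3, 4, 6, 7], Dom [1, 3, 4, 6, 7], Dom [1, 3, 4, 6, 7], Dom [1, 2, 4, 6, 7],
      Dom [0, 1, 3, 6, 7], Dom [1, 2, 6, 7]],
     [Dom [0, 4, 5], Relabel 6 [2, 0, 1, 4, 5, 6, 3], Relabel 6 [1, 0, 2, 4, 5, 6, 3],
      Relabel 6 [1, 0, 3, 4, 5, 6, 2]],
     [Dom [1, 3, 4, 7, 8], Dom [1, 3, 4, 7, 8], Dom [1, 3, 4, 7, 8], Dom [1, 2, 4, 7, 8],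
      Dom [0, 1, 3, 7, 8], Dom [1, 2, 7, 8], Dom [1, 3, 4, 7, 8]],
     [Relabel 8 [3, 2, 1, 0, 4, 5, 6], Relabel 9 [3, 2, 1, 4, 5, 6, 0],
      Relabel 9 [0, 1, 2, 4, 5, 6, 3], Relabel 8 [0, 1, 2, 3, 4, 5, 6]]]"

definition valid_certs ::
    "(nat \<Rightarrow> nat \<times> (nat \<times> nat) list \<Rightarrow> nat \<times> (nat \<times> nat) list) \<Rightarrow> cert list list \<Rightarrow> bool" where
  "valid_certs att css \<longleftrightarrow> length css \<le> length small_shapes \<and>
     (\<forall>t<length css. length (css ! t) = fst (small_shapes ! t) \<and>
       (\<forall>i<fst (small_shapes ! t). valid_cert (att i (small_shapes ! t)) (css ! t ! i)))"

text \<open>The reductions by a leaf or a path of two vertices win strictly, so rows are required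
  only for the five shapes that violate the bound. A path of three vertices preserves equality, so
  its table also has rows for the three equality shapes without two legs.\<close>

lemma valid_certs_chain:
  "valid_certs pendant_shape chain1_certs"
  "valid_certs (\<lambda>i X. pendant_shape (fst X) (pendant_shape i X)) chain2_certs"
  "valid_certs (\<lambda>i X. pendant_shape (Suc (fst X)) (pendant_shape (fst X) (pendant_shape i X)))
     chain3_certs"
  by code_simp+

section \<open>Graphs with pendant paths on a connected hub\<close>

text \<open>
  Leg \<open>i\<close> is the path \<open>A i\<close>, \<open>B i\<close>, \<open>L i\<close>. The hub consists of the center \<open>C\<close> and all
  \<open>A i\<close>, and it may carry arbitrary edges as long as it is connected.
\<close>

datatype leg_vertex = C | A nat | B nat | L nat

definition leg_verts :: "nat \<Rightarrow> leg_vertex set" where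
  "leg_verts k = insert C (A ` {1..k} \<union> B ` {1..k} \<union> L ` {1..k})"

definition hub :: "nat \<Rightarrow> leg_vertex set" where
  "hub k = insert C (A ` {1..k})"

definition legs_AB :: "nat \<Rightarrow> leg_vertex set" where
  "legs_AB k = A ` {1..k} \<union> B ` {1..k}"

lemma finite_legs_AB: "finite (legs_AB k)"
  by (simp add: legs_AB_def)

lemma card_legs_AB: "card (legs_AB k) = 2 * k"
  unfolding legs_AB_def by (subst card_Un_disjoint) (auto simp: card_image inj_on_def)

lemma card_leg_verts: "card (leg_verts k) = 3 * k + 1"
proof -
  have "card (A ` {1..k} \<union> B ` {1..k} \<union> L ` {1..k}) = 3 * k"
    by (subst card_Un_disjoint; (subst card_Un_disjoint)?) (auto simp: card_image inj_on_def)
  then show ?thesis unfolding leg_verts_def by (subst card_insert_disjoint) auto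
qed

text \<open>All vertices \<open>A i\<close>, \<open>B i\<close> form a dominating set with equality in the bound, so any
  exchange that loses a vertex gives the strict bound.\<close>

lemma dom_strict_legs_swapI:
  assumes "X \<subseteq> legs_AB k" "card Y < card X" "finite Y" "Y \<subseteq> leg_verts k"
    and "S = legs_AB k - X \<union> Y"
    and "served R S C"
    and "\<And>i. i \<in> {1..k} \<Longrightarrow> served R S (A i)"
    and "\<And>i. i \<in> {1..k} \<Longrightarrow> served R S (B i)"
    and "\<And>i. i \<in> {1..k} \<Longrightarrow> served R S (L i)"
  shows "dom_strict (leg_verts k) R"
proof -
  have "card S \<le> card (legs_AB k - X) + card Y"
    unfolding assms(5) by (rule card_Un_le)
  also have "card (legs_AB k - X) = 2 * k - card X"
    using assms(1) finite_legs_AB by (simp add: card_Diff_subset finite_subset card_legs_AB)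
  finally have "card S \<le> 2 * k - card X + card Y" .
  moreover have "card X \<le> 2 * k"
    using assms(1) finite_legs_AB card_legs_AB by (metis card_mono)
  ultimately have "card S < 2 * k" using assms(2) by linarith
  moreover have "dom_set (leg_verts k) R S"
    using assms(4-9) unfolding dom_set_def leg_verts_def legs_AB_def by auto
  ultimately show ?thesis unfolding dom_strict_def card_leg_verts by (intro exI[of _ S]) auto
qed

text \<open>Edges other than those listed are left open, so that legs found in a spanning tree
  remain legs in the whole graph. Stating connectedness by cuts yields the edge leaving a chosen
  part of the hub at once, without following paths.\<close>

locale legs =
  fixes k :: nat and R :: "leg_vertex rel"
  assumes symR: "(x, y) \<in> R \<Longrightarrow> (y, x) \<in> R"
    and AB: "i \<in> {1..k} \<Longrightarrow> (A i, B i) \<in> R"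
    and BL: "i \<in> {1..k} \<Longrightarrow> (B i, L i) \<in> R"
    and cut: \<comment> \<open>connectedness of the hub\<close>
      "C \<in> U \<Longrightarrow> U \<subset> hub k \<Longrightarrow> \<exists>x\<in>U. \<exists>y\<in>hub k - U. (x, y) \<in> R"
begin

lemmas BA = AB[THEN symR] and LB = BL[THEN symR]

definition adj :: "nat \<Rightarrow> nat \<Rightarrow> bool" where
  "adj i j \<longleftrightarrow> i \<in> {1..k} \<and> j \<in> {1..k} \<and> i \<noteq> j \<and> (A i, A j) \<in> R"

lemma adj_sym: "adj i j \<Longrightarrow> adj j i"
  using symR[of "A i" "A j"] by (simp add: adj_def)

lemma adjD: "adj i j \<Longrightarrow> (A i, A j) \<in> R" "adj i j \<Longrightarrow> (A j, A i) \<in> R"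
  "adj i j \<Longrightarrow> i \<in> {1..k}" "adj i j \<Longrightarrow> j \<in> {1..k}" "adj i j \<Longrightarrow> i \<noteq> j"
  using symR[of "A i" "A j"] by (simp_all add: adj_def)

text \<open>Isolating \<open>A i\<close> is a cut of the hub; if no other \<open>A j\<close> is
  adjacent, the crossing edge can only come from \<open>C\<close>.\<close>

lemma cut_AC:
  assumes "i \<in> {1..k}" "\<And>j. \<not> adj i j"
  shows "(C, A i) \<in> R"
proof -
  have "A i \<in> hub k" using assms(1) by (auto simp: hub_def)
  then have "hub k - {A i} \<subset> hub k" by blast
  then obtain x where x: "x \<in> hub k" "x \<noteq> A i" "(x, A i) \<in> R"
    using cut[of "hub k - {A i}"] by (auto simp: hub_def)
  show ?thesis
  proof (cases x)
    case (A j)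
    then have "adj i j" using x assms(1) symR[OF x(3)] by (auto simp: hub_def adj_def)
    then show ?thesis using assms(2) by blast
  qed (use x in \<open>auto simp: hub_def\<close>)
qed

lemma C_adj:
  assumes "1 \<le> k"
  obtains i where "i \<in> {1..k}" "(C, A i) \<in> R"
proof -
  have "\<exists>x\<in>{C}. \<exists>y\<in>hub k - {C}. (x, y) \<in> R"
    using assms by (intro cut) (auto simp: hub_def image_subset_iff)
  then show ?thesis using that unfolding hub_def by blast
qed

text \<open>With two legs, \<open>{C, A i}\<close> is a proper part of the hub and some edge leaves
  it. This keeps \<open>C\<close> served after \<open>A i\<close> is dropped.\<close>

lemma C_A_escape:
  assumes "2 \<le> k" "i \<in> {1..k}"
  obtains j where "j \<in> {1..k}" "j \<noteq> i" "(C, A j) \<in> R \<or> adj i j"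
proof -
  have "{C, A i} \<noteq> hub k"
  proof
    assume "{C, A i} = hub k"
    moreover have "A 1 \<in> hub k" "A 2 \<in> hub k" using assms by (auto simp: hub_def)
    ultimately have "A 1 \<in> {C, A i}" "A 2 \<in> {C, A i}" by simp_all
    then show False by simp
  qed
  then have "\<exists>x\<in>{C, A i}. \<exists>y\<in>hub k - {C, A i}. (x, y) \<in> R"
    using assms by (intro cut) (auto simp: hub_def)
  then obtain x y where xy: "x \<in> {C, A i}" "y \<in> hub k - {C, A i}" "(x, y) \<in> R" by blast
  then obtain j where "j \<in> {1..k}" "y = A j" "j \<noteq> i" unfolding hub_def by blast
  then show ?thesis using that[of j] xy assms(2) by (auto simp: adj_def)
qed

lemma dom_weak: 
  assumes "1 \<le> k"
  shows "dom_weak (leg_verts k) R"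
proof -
  obtain i where i: "i \<in> {1..k}" "(C, A i) \<in> R" using C_adj assms by blast
  have "served R (legs_AB k) C" using i by (auto intro: served_adjI simp: legs_AB_def)
  moreover have "served R (legs_AB k) (A j)" "served R (legs_AB k) (B j)"
    "served R (legs_AB k) (L j)"
    if "j \<in> {1..k}" for j
    using AB[OF that] BA[OF that] LB[OF that] that
    by (auto intro: served_adjI simp: legs_AB_def)
  ultimately have "dom_set (leg_verts k) R (legs_AB k)"
    unfolding dom_set_def leg_verts_def by (auto simp: legs_AB_def)
  then show ?thesis
    unfolding dom_weak_def by (intro exI[of _ "legs_AB k"]) (simp add: card_legs_AB card_leg_verts)
qed

lemma Suc_leg:
  assumes R': "\<And>x y. (x, y) \<in> R' \<Longrightarrow> (y, x) \<in> R'" "R \<subseteq> R'"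
    and "(A (Suc k), B (Suc k)) \<in> R'" "(B (Suc k), L (Suc k)) \<in> R'"
    and "j \<in> {1..Suc k}"
  shows "(A j, B j) \<in> R'" "(B j, A j) \<in> R'" "(B j, L j) \<in> R'" "(L j, B j) \<in> R'"
proof -
  show 1: "(A j, B j) \<in> R'" using assms AB[of j] by (cases "j = Suc k") auto
  show 2: "(B j, L j) \<in> R'" using assms BL[of j] by (cases "j = Suc k") auto
  show "(B j, A j) \<in> R'" "(L j, B j) \<in> R'" using R'(1)[OF 1] R'(1)[OF 2] .
qed

text \<open>A cut of the enlarged hub either contains the whole old hub, and is then crossed by the
  new edge at \<open>h\<close>, or it cuts the old hub.\<close>

lemma legs_Suc:
  assumes "\<And>x y. (x, y) \<in> R' \<Longrightarrow> (y, x) \<in> R'" "R \<subseteq> R'"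
    and "(A (Suc k), B (Suc k)) \<in> R'" "(B (Suc k), L (Suc k)) \<in> R'"
    and "h \<in> hub k" "(h, A (Suc k)) \<in> R'"
  shows "legs (Suc k) R'"
proof
  fix U assume U: "C \<in> U" "U \<subset> hub (Suc k)"
  have hub: "hub (Suc k) = insert (A (Suc k)) (hub k)"
    by (auto simp: hub_def atLeastAtMostSuc_conv)
  have new: "A (Suc k) \<notin> hub k" by (auto simp: hub_def)
  show "\<exists>x\<in>U. \<exists>y\<in>hub (Suc k) - U. (x, y) \<in> R'"
  proof (cases "hub k \<subseteq> U")
    case True
    have "A (Suc k) \<notin> U"
    proof
      assume "A (Suc k) \<in> U"
      then have "hub (Suc k) \<subseteq> U" using True unfolding hub by simp
      then show False using U(2) by simp
    qed
    then have "A (Suc k) \<in> hub (Suc k) - U" unfolding hub by simp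
    moreover have "h \<in> U" using True assms(5) by (rule subsetD)
    ultimately show ?thesis using assms(6) by (intro bexI)
  next
    case False
    have "C \<in> U \<inter> hub k" using U(1) by (simp add: hub_def)
    moreover have "U \<inter> hub k \<subset> hub k" using False by (intro psubsetI) auto
    ultimately obtain x y where xy: "x \<in> U \<inter> hub k" "y \<in> hub k - (U \<inter> hub k)" "(x, y) \<in> R"
      using cut by meson
    then have "x \<in> U" "y \<in> hub (Suc k) - U" "(x, y) \<in> R'" using assms(2) unfolding hub by auto
    then show ?thesis by blast
  qed
next
  fix i assume "i \<in> {1..Suc k}"
  then show "(A i, B i) \<in> R'" "(B i, L i) \<in> R'"
    using Suc_leg[OF assms(1-4)] by auto
qed (use assms in auto)

lemma dom_strict_Suc_B:
  assumes R': "\<And>x y. (x, y) \<in> R' \<Longrightarrow> (y, x) \<in> R'" "R \<subseteq> R'"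
    and "(A (Suc k), B (Suc k)) \<in> R'" "(B (Suc k), L (Suc k)) \<in> R'"
    and i: "i \<in> {1..k}" "(B i, A (Suc k)) \<in> R'" and "2 \<le> k"
  shows "dom_strict (leg_verts (Suc k)) R'"
proof -
  define S where "S = legs_AB (Suc k) - {A i} \<union> {}"
  have S: "x \<in> S \<longleftrightarrow> (\<exists>j\<in>{1..Suc k}. x = A j \<and> j \<noteq> i \<or> x = B j)" for x
    unfolding S_def legs_AB_def by auto
  have leg: "(A j, B j) \<in> R'" "(B j, A j) \<in> R'" "(L j, B j) \<in> R'" if "j \<in> {1..Suc k}" for j
    using Suc_leg[OF R' assms(3,4) that] by auto
  show ?thesis
  proof (rule dom_strict_legs_swapI[OF _ _ _ _ S_def])
    obtain j where j: "j \<in> {1..k}" "j \<noteq> i" "(C, A j) \<in> R \<or> adj i j"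
      using C_A_escape \<open>2 \<le> k\<close> i by metis
    show "served R' S C"
    proof (cases "(C, A j) \<in> R")
      case True
      then show ?thesis using j R' by (intro served_adjI[of _ "A j"]) (auto simp: S)
    next
      case False
      then have ij: "adj i j" using j by blast
      show ?thesis
      proof (cases "(C, A i) \<in> R")
        case True
        then show ?thesis using ij[THEN adjD(1)] j R' leg[of i] i
          by (intro served_twoI[of _ "A i" _ "B i" "A i" "A j"]) (auto simp: S)
      next
        case False
        obtain m where m: "m \<in> {1..k}" "(C, A m) \<in> R" using C_adj \<open>2 \<le> k\<close>
          by (metis One_nat_def Suc_leD numeral_2_eq_2)
        then have "m \<noteq> i" using False by blast
        then show ?thesis using m R' by (intro served_adjI[of _ "A m"]) (auto simp: S)
      qed
    qed
    show "served R' S (B j)" if "j \<in> {1..Suc k}" for j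
    proof (cases "j = i")
      case True
      then show ?thesis using i by (intro served_adjI[of _ "A (Suc k)"]) (auto simp: S)
    next
      case False
      then show ?thesis using leg[OF that] that by (intro served_adjI[of _ "A j"]) (auto simp: S)
    qed
    show "served R' S (A j)" "served R' S (L j)" if "j \<in> {1..Suc k}" for j
      using leg[OF that] that by (auto intro!: served_adjI[of _ "B j"] simp: S)
  qed (use i in \<open>auto simp: legs_AB_def\<close>)
qed

text \<open>The leaf \<open>L i\<close> no longer depends on \<open>B i\<close>. If
  \<open>A i\<close> has a neighbour \<open>A j\<close>, then \<open>B i\<close> is dropped.
  Otherwise \<open>A i\<close> is adjacent to \<open>C\<close>, and \<open>C\<close> replaces both
  \<open>A i\<close> and \<open>B i\<close>; then \<open>B i\<close> has \<open>C\<close> and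
  \<open>A (Suc k)\<close> at two steps, on its two different sides.\<close>

lemma dom_strict_Suc_L:
  assumes R': "\<And>x y. (x, y) \<in> R' \<Longrightarrow> (y, x) \<in> R'" "R \<subseteq> R'"
    and "(A (Suc k), B (Suc k)) \<in> R'" "(B (Suc k), L (Suc k)) \<in> R'"
    and i: "i \<in> {1..k}" "(L i, A (Suc k)) \<in> R'" and "2 \<le> k"
  shows "dom_strict (leg_verts (Suc k)) R'"
proof -
  have leg: "(A j, B j) \<in> R'" "(B j, A j) \<in> R'" "(L j, B j) \<in> R'" if "j \<in> {1..Suc k}" for j
    using Suc_leg[OF R' assms(3,4) that] by auto
  show ?thesis
  proof (cases "\<exists>j. adj i j")
    case True
    then obtain j where j: "adj i j" by blast
    define S where "S = legs_AB (Suc k) - {B i} \<union> {}"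
    have S: "x \<in> S \<longleftrightarrow> (\<exists>j\<in>{1..Suc k}. x = A j \<or> x = B j \<and> j \<noteq> i)" for x
      unfolding S_def legs_AB_def by auto
    show ?thesis
    proof (rule dom_strict_legs_swapI[OF _ _ _ _ S_def])
      obtain m where m: "m \<in> {1..k}" "(C, A m) \<in> R" using C_adj \<open>2 \<le> k\<close>
        by (metis One_nat_def Suc_leD numeral_2_eq_2)
      then show "served R' S C" using R' by (intro served_adjI[of _ "A m"]) (auto simp: S)
      show "served R' S (A m)" if "m \<in> {1..Suc k}" for m
      proof (cases "m = i")
        case True
        then show ?thesis using j[THEN adjD(1)] j[THEN adjD(4)] R'
          by (intro served_adjI[of _ "A j"]) (auto simp: S)
      next
        case False
        then show ?thesis using leg[OF that] that by (intro served_adjI[of _ "B m"]) (auto simp: S)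
      qed
      show "served R' S (L m)" if "m \<in> {1..Suc k}" for m
      proof (cases "m = i")
        case True
        then show ?thesis using i by (intro served_adjI[of _ "A (Suc k)"]) (auto simp: S)
      next
        case False
        then show ?thesis using leg[OF that] that by (intro served_adjI[of _ "B m"]) (auto simp: S)
      qed
      show "served R' S (B m)" if "m \<in> {1..Suc k}" for m
        using leg[OF that] that by (auto intro!: served_adjI[of _ "A m"] simp: S)
    qed (use i in \<open>auto simp: legs_AB_def\<close>)
  next
    case False
    then have AC: "(C, A i) \<in> R'" "(A i, C) \<in> R'" using cut_AC i R' by blast+
    define S where "S = legs_AB (Suc k) - {A i, B i} \<union> {C}"
    have S: "x \<in> S \<longleftrightarrow> x = C \<or> (\<exists>j\<in>{1..Suc k}. j \<noteq> i \<and> (x = A j \<or> x = B j))" for x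
      unfolding S_def legs_AB_def by auto
    show ?thesis
    proof (rule dom_strict_legs_swapI[OF _ _ _ _ S_def])
      obtain j where j: "j \<in> {1..k}" "j \<noteq> i" "(C, A j) \<in> R"
        using C_A_escape \<open>2 \<le> k\<close> i False by metis
      then show "served R' S C" using R' by (intro served_adjI[of _ "A j"]) (auto simp: S)
      show "served R' S (A m)" if "m \<in> {1..Suc k}" for m
      proof (cases "m = i")
        case True
        then show ?thesis using AC by (intro served_adjI[of _ C]) (auto simp: S)
      next
        case False
        then show ?thesis using leg[OF that] that by (intro served_adjI[of _ "B m"]) (auto simp: S)
      qed
      show "served R' S (B m)" if "m \<in> {1..Suc k}" for m
      proof (cases "m = i")
        case True
        moreover have "(B i, L i) \<in> R'" using BL i R' by blast
        ultimately show ?thesis using AC leg[of i] i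
          by (intro served_twoI[of _ "A i" _ C "L i" "A (Suc k)"]) (auto simp: S)
      next
        case False
        then show ?thesis using leg[OF that] that by (intro served_adjI[of _ "A m"]) (auto simp: S)
      qed
      show "served R' S (L m)" if "m \<in> {1..Suc k}" for m
      proof (cases "m = i")
        case True
        then show ?thesis using i by (intro served_adjI[of _ "A (Suc k)"]) (auto simp: S)
      next
        case False
        then show ?thesis using leg[OF that] that by (intro served_adjI[of _ "B m"]) (auto simp: S)
      qed
    qed (use i in \<open>auto simp: legs_AB_def leg_verts_def\<close>)
  qed
qed

end

section \<open>Structure of the hub when no vertex can be saved\<close>

locale tight_legs = legs +
  assumes k3: "3 \<le> k" and not_strict: "\<not> dom_strict (leg_verts k) R"
begin

lemma no_swap:
  assumes "X \<subseteq> legs_AB k" "card Y < card X" "finite Y" "Y \<subseteq> leg_verts k"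
    and "S = legs_AB k - X \<union> Y"
    and "served R S C"
    and "\<And>i. i \<in> {1..k} \<Longrightarrow> served R S (A i)"
    and "\<And>i. i \<in> {1..k} \<Longrightarrow> served R S (B i)"
    and "\<And>i. i \<in> {1..k} \<Longrightarrow> served R S (L i)"
  shows False
  using dom_strict_legs_swapI[OF assms(1-6)] assms(7-9) not_strict by blast

lemma leg: 
  assumes "i \<in> {1..k}"
  shows "(A i, B i) \<in> R" "(B i, A i) \<in> R" "(B i, L i) \<in> R" "(L i, B i) \<in> R"
  using AB[OF assms] BA[OF assms] BL[OF assms] LB[OF assms] .

lemma third_leg:
  obtains m where "m \<in> {1..k}" "m \<noteq> i" "m \<noteq> j"
proof -
  have "\<exists>m\<in>{1,2,3::nat}. m \<noteq> i \<and> m \<noteq> j"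
    by (cases "i = 1"; cases "j = 1"; cases "i = 2"; cases "j = 2") auto
  then obtain m where "m \<in> {1,2,3::nat}" "m \<noteq> i" "m \<noteq> j" by blast
  then show ?thesis using that[of m] k3 by auto
qed

lemma cut_two:
  assumes "i \<in> {1..k}" "j \<in> {1..k}"
  shows "\<exists>x\<in>hub k - {A i, A j}. (x, A i) \<in> R \<or> (x, A j) \<in> R"
proof -
  have "A i \<in> hub k" "C \<in> hub k - {A i, A j}" using assms by (auto simp: hub_def)
  then have "hub k - {A i, A j} \<subset> hub k" by blast
  then obtain x y where "x \<in> hub k - {A i, A j}" "y \<in> hub k - (hub k - {A i, A j})" "(x, y) \<in> R"
    using cut[OF \<open>C \<in> _\<close>] by blast
  then show ?thesis by blast
qed

text \<open>\<open>B i\<close> reaches both \<open>A p\<close> and \<open>A q\<close> through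
  \<open>A i\<close>, so \<open>A i\<close> itself is dispensable.\<close>

lemma no_drop_one:
  assumes p: "adj i p" and q: "adj i q" and "p \<noteq> q" and C: "served R (legs_AB k - {A i}) C"
  shows False
proof -
  define S where "S = legs_AB k - {A i} \<union> {}"
  have S: "x \<in> S \<longleftrightarrow> x \<in> B ` {1..k} \<or> x \<in> A ` ({1..k} - {i})" for x
    unfolding S_def legs_AB_def by auto
  note i = adjD(3)[OF p]
  show False
  proof (rule no_swap[OF _ _ _ _ S_def])
    show "served R S C" using C by (simp add: S_def)
    fix m assume m: "m \<in> {1..k}"
    show "served R S (A m)" "served R S (L m)"
      using leg[OF m] m by (auto intro!: served_adjI[of _ "B m"] simp: S)
    show "served R S (B m)"
    proof (cases "m = i")
      case True
      then show ?thesis using leg[OF m] adjD[OF p] adjD[OF q] \<open>p \<noteq> q\<close>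
        by (intro served_twoI[of _ "A i" _ "A p" "A i" "A q"]) (auto simp: S)
    next
      case False
      then show ?thesis using leg[OF m] m by (intro served_adjI[of _ "A m"]) (auto simp: S)
    qed
  qed (use i in \<open>auto simp: legs_AB_def\<close>)
qed

lemma C_adj_two: "\<exists>i\<in>{1..k}. \<exists>j\<in>{1..k}. i \<noteq> j \<and> (C, A i) \<in> R \<and> (C, A j) \<in> R"
proof (rule ccontr)
  assume "\<not> ?thesis"
  then have one: "i = j" if "i \<in> {1..k}" "j \<in> {1..k}" "(C, A i) \<in> R" "(C, A j) \<in> R" for i j
    using that by blast
  have "1 \<le> k" using k3 by simp
  then obtain m where m: "m \<in> {1..k}" "(C, A m) \<in> R" by (rule C_adj)
  have uniq: "j = j'" if "i \<noteq> m" "adj i j" "adj i j'" for i j j'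
  proof (rule ccontr)
    assume "j \<noteq> j'"
    have "served R (legs_AB k - {A i}) C"
      using m \<open>i \<noteq> m\<close> by (intro served_adjI[of _ "A m"]) (auto simp: legs_AB_def)
    then show False using no_drop_one[OF that(2,3) \<open>j \<noteq> j'\<close>] by simp
  qed
  \<comment> \<open>Otherwise \<open>A j\<close> has exactly one partner \<open>A i\<close>, and the
    two together would be cut off from the rest of the hub.\<close>
  have all: "adj m j" if j: "j \<in> {1..k}" "j \<noteq> m" for j
  proof (rule ccontr)
    assume nj: "\<not> adj m j"
    have "\<exists>i. adj j i"
    proof (rule ccontr)
      assume "\<nexists>i. adj j i"
      then have "(C, A j) \<in> R" using cut_AC j by blast
      then show False using one m j by blast
    qed
    then obtain i where i: "adj j i" by blast
    have "i \<noteq> m" using nj adj_sym[OF i] by blast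
    obtain x where x: "x \<in> hub k - {A i, A j}" "(x, A i) \<in> R \<or> (x, A j) \<in> R"
      using cut_two[of i j] j adjD(4)[OF i] by blast
    show False
    proof (cases x)
      case C
      then show False using x one m j \<open>i \<noteq> m\<close> i[THEN adjD(4)] by blast
    next
      case (A p)
      then have p: "p \<in> {1..k}" "p \<noteq> i" "p \<noteq> j" using x by (auto simp: hub_def)
      have "adj i p \<or> adj j p"
        using x(2) symR[of "A p" "A i"] symR[of "A p" "A j"] p i[THEN adjD(4)] j
        unfolding A adj_def by auto
      then show False
        using uniq[of j i p] uniq[of i j p] i adj_sym[OF i] \<open>i \<noteq> m\<close> j(2) p by blast
    qed (use x in \<open>auto simp: hub_def\<close>)
  qed
  obtain p where p: "p \<in> {1..k}" "p \<noteq> m" using third_leg[of m m] by blast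
  obtain q where q: "q \<in> {1..k}" "q \<noteq> m" "q \<noteq> p" using third_leg[of m p] by blast
  have "served R (legs_AB k - {A m}) C"
    using m p leg[OF m(1)] all[OF p, THEN adjD(1)]
    by (intro served_twoI[of _ "A m" _ "B m" "A m" "A p"]) (auto simp: legs_AB_def)
  then show False using no_drop_one[OF all[OF p] all[OF q(1,2)]] q(3) by blast
qed

text \<open>Two neighbours \<open>A i\<close>, \<open>A j\<close> of \<open>C\<close> put
  \<open>B i\<close> and \<open>B j\<close> two steps away. From here on \<open>C\<close> needs no
  attention in exchanges that keep all \<open>B i\<close>.\<close>

lemma served_C:
  assumes "B ` {1..k} \<subseteq> S"
  shows "served R S C"
proof -
  obtain i j where "i \<in> {1..k}" "j \<in> {1..k}" "i \<noteq> j" "(C, A i) \<in> R" "(C, A j) \<in> R"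
    using C_adj_two by blast
  then show ?thesis using assms leg(1)[of i] leg(1)[of j]
    by (intro served_twoI[of _ "A i" _ "B i" "A j" "B j"]) auto
qed

text \<open>Thus the edges among the \<open>A i\<close> form a matching.\<close>

lemma adj_unique: "adj i j \<Longrightarrow> adj i j' \<Longrightarrow> j = j'"
  using no_drop_one[of i j j'] served_C[of "legs_AB k - {A i}"] by (auto simp: legs_AB_def)

text \<open>Matched only to each other, \<open>A i\<close> and \<open>A j\<close> would be cut off
  from the hub unless one of them meets \<open>C\<close>.\<close>

lemma adj_pair_C:
  assumes ij: "adj i j"
  shows "(C, A i) \<in> R \<or> (C, A j) \<in> R"
proof -
  obtain x where x: "x \<in> hub k - {A i, A j}" "(x, A i) \<in> R \<or> (x, A j) \<in> R"
    using cut_two[of i j] ij[THEN adjD(3)] ij[THEN adjD(4)] by blast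
  show ?thesis
  proof (cases x)
    case C
    then show ?thesis using x by blast
  next
    case (A p)
    then have p: "p \<in> {1..k}" "p \<noteq> i" "p \<noteq> j" using x by (auto simp: hub_def)
    have "adj i p \<or> adj j p"
      using x(2) symR[of "A p" "A i"] symR[of "A p" "A j"] p ij[THEN adjD(3)] ij[THEN adjD(4)]
      unfolding A adj_def by auto
    then show ?thesis using adj_unique[of i j p] adj_unique[of j i p] ij adj_sym[OF ij] p by blast
  qed (use x in \<open>auto simp: hub_def\<close>)
qed

text \<open>Two disjoint matching edges allow one exchange: choose on each the end adjacent to
  \<open>C\<close>, drop both ends and add \<open>C\<close>. Through its dropped \<open>A i\<close>,
  each affected \<open>B i\<close> reaches \<open>C\<close> and the partner of
  \<open>A i\<close>.\<close>

lemma adj_only_pair: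
  assumes "adj i j" "adj p q"
  shows "p = i \<and> q = j \<or> p = j \<and> q = i"
proof (rule ccontr)
  assume neg: "\<not> ?thesis"
  have d: "p \<noteq> i" "p \<noteq> j" "q \<noteq> i" "q \<noteq> j"
    using neg adj_unique assms assms[THEN adj_sym] by metis+
  have key: False if ij: "adj i j" and pq: "adj p q" and Ci: "(C, A i) \<in> R" and Cp: "(C, A p) \<in> R"
      and "p \<noteq> i" "p \<noteq> j" "q \<noteq> i" "q \<noteq> j" for i j p q
  proof -
    define S where "S = legs_AB k - {A i, A p} \<union> {C}"
    have S: "x \<in> S \<longleftrightarrow> x = C \<or> x \<in> B ` {1..k} \<or> x \<in> A ` ({1..k} - {i, p})" for x
      unfolding S_def legs_AB_def by auto
    show False
    proof (rule no_swap[OF _ _ _ _ S_def])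
      show "served R S C" by (rule served_C) (auto simp: S)
      fix m assume m: "m \<in> {1..k}"
      show "served R S (A m)" "served R S (L m)"
        using leg[OF m] m by (auto intro!: served_adjI[of _ "B m"] simp: S)
      consider "m = i" | "m = p" | "m \<noteq> i" "m \<noteq> p" by blast
      then show "served R S (B m)"
      proof cases
        case 1
        then show ?thesis using leg[OF m] adjD[OF ij] symR[OF Ci] \<open>p \<noteq> j\<close>
          by (intro served_twoI[of _ "A i" _ "A j" "A i" C]) (auto simp: S)
      next
        case 2
        then show ?thesis using leg[OF m] adjD[OF pq] symR[OF Cp] \<open>q \<noteq> i\<close>
          by (intro served_twoI[of _ "A p" _ "A q" "A p" C]) (auto simp: S)
      next
        case 3
        then show ?thesis using leg[OF m] m by (intro served_adjI[of _ "A m"]) (auto simp: S)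
      qed
    qed (use adjD(3)[OF ij] adjD(3)[OF pq] \<open>p \<noteq> i\<close> in \<open>auto simp: legs_AB_def leg_verts_def\<close>)
  qed
  consider "(C, A i) \<in> R" "(C, A p) \<in> R" | "(C, A i) \<in> R" "(C, A q) \<in> R"
    | "(C, A j) \<in> R" "(C, A p) \<in> R" | "(C, A j) \<in> R" "(C, A q) \<in> R"
    using adj_pair_C[OF assms(1)] adj_pair_C[OF assms(2)] by blast
  then show False
  proof cases
    case 1 then show False using key[OF assms] d by blast
  next
    case 2 then show False using key[OF assms(1) adj_sym[OF assms(2)]] d by blast
  next
    case 3 then show False using key[OF adj_sym[OF assms(1)] assms(2)] d by blast
  next
    case 4 then show False using key[OF adj_sym[OF assms(1)] adj_sym[OF assms(2)]] d by blast
  qed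
qed

end

section \<open>Exclusion of further edges at \<open>B i\<close> and \<open>L i\<close>\<close>

context tight_legs
begin

text \<open>The name \<open>w\<close> is given to an end of the pair that meets \<open>C\<close>.
  Whether \<open>u\<close> meets \<open>C\<close> as well stays open and later separates the
  families F and G.\<close>

lemma hub_cases:
  obtains (star) "\<And>i j. \<not> adj i j"
  | (pair) w u where "adj w u" "(C, A w) \<in> R"
proof (cases "\<exists>i j. adj i j")
  case True
  then obtain i j where ij: "adj i j" by blast
  then show ?thesis using adj_pair_C[OF ij] pair[OF ij] pair[OF adj_sym[OF ij]] by blast
qed (use star in blast)

lemma C_adj_other:
  obtains m where "m \<in> {1..k}" "m \<noteq> i" "(C, A m) \<in> R"
  using C_adj_two by metis

lemma not_adj_outside_pair:
  "adj w u \<Longrightarrow> m \<noteq> w \<Longrightarrow> m \<noteq> u \<Longrightarrow> \<not> adj m j"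
  using adj_only_pair by blast

text \<open>With a second neighbour \<open>z\<close> of \<open>L i\<close>, the vertex
  \<open>B i\<close> should be dispensable: \<open>B i\<close> keeps \<open>A i\<close>, and
  \<open>L i\<close> is served by \<open>z\<close>, or through \<open>C\<close> by two of the
  \<open>A j\<close> if \<open>z = C\<close>. Only \<open>A i\<close> may lose its service. It is
  safe with a neighbour among the \<open>A j\<close>, and in a star it reaches two other
  \<open>A j\<close> through \<open>C\<close>.\<close>

lemma no_L_edge:
  assumes i: "i \<in> {1..k}" and z: "(L i, z) \<in> R" "z \<in> leg_verts k" "z \<noteq> B i" "z \<notin> range L"
  shows False
proof -
  have zc: "z = C \<or> (\<exists>j\<in>{1..k}. z = A j) \<or> (\<exists>j\<in>{1..k}. z = B j \<and> j \<noteq> i)"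
    using z(2-4) by (auto simp: leg_verts_def)
  have plain: False if Ai: "served R (legs_AB k - {B i}) (A i)"
  proof -
    define S where "S = legs_AB k - {B i} \<union> {}"
    have S: "x \<in> S \<longleftrightarrow> x \<in> A ` {1..k} \<or> x \<in> B ` ({1..k} - {i})" for x
      unfolding S_def legs_AB_def by auto
    show False
    proof (rule no_swap[OF _ _ _ _ S_def])
      obtain m where "m \<in> {1..k}" "(C, A m) \<in> R" using C_adj_other by metis
      then show "served R S C" by (intro served_adjI[of _ "A m"]) (auto simp: S)
      fix m assume m: "m \<in> {1..k}"
      show "served R S (A m)"
      proof (cases "m = i")
        case True
        then show ?thesis using Ai by (simp add: S_def)
      next
        case False
        then show ?thesis using leg[OF m] m by (intro served_adjI[of _ "B m"]) (auto simp: S)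
      qed
      show "served R S (B m)" using leg[OF m] m by (intro served_adjI[of _ "A m"]) (auto simp: S)
      show "served R S (L m)"
      proof (cases "m = i")
        case True
        show ?thesis
        proof (cases "z = C")
          case zC: True
          obtain p q where "p \<in> {1..k}" "q \<in> {1..k}" "p \<noteq> q" "(C, A p) \<in> R" "(C, A q) \<in> R"
            using C_adj_two by blast
          then show ?thesis using z(1) unfolding True zC
            by (intro served_twoI[of _ C _ "A p" C "A q"]) (auto simp: S)
        next
          case False
          then show ?thesis
            using zc z(1) unfolding True by (intro served_adjI[of _ z]) (auto simp: S)
        qed
      next
        case False
        then show ?thesis using leg[OF m] m by (intro served_adjI[of _ "B m"]) (auto simp: S)
      qed
    qed (use i in \<open>auto simp: legs_AB_def\<close>)
  qed
  show False
  proof (cases "\<exists>j. adj i j")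
    case True
    then obtain j where "adj i j" by blast
    note j = adjD[OF this]
    show False using j by (intro plain served_adjI[of _ "A j"]) (auto simp: legs_AB_def)
  next
    case ni: False
    then have Ci: "(C, A i) \<in> R" using cut_AC i by blast
    show False
    proof (cases rule: hub_cases)
      case star
      obtain p where p: "p \<in> {1..k}" "p \<noteq> i" using third_leg[of i i] by blast
      obtain q where q: "q \<in> {1..k}" "q \<noteq> i" "q \<noteq> p" using third_leg[of i p] by blast
      have "(C, A p) \<in> R" "(C, A q) \<in> R" using cut_AC star p q by blast+
      then show False using symR[OF Ci] p q
        by (intro plain served_twoI[of _ C _ "A p" C "A q"]) (auto simp: legs_AB_def)
    next
      case (pair w u)
      note wu = adjD[OF pair(1)]
      have iw: "i \<noteq> w" "i \<noteq> u" using ni pair(1) adj_sym[OF pair(1)] by blast+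
      \<comment> \<open>Adding \<open>C\<close> rescues \<open>A i\<close>. To lose a vertex all the
        same, \<open>A w\<close> goes too: \<open>C\<close> and \<open>A u\<close> are both reached
        through it, from \<open>B w\<close> and, if \<open>z = A w\<close>, from
        \<open>L i\<close>.\<close>
      define S where "S = legs_AB k - {A w, B i} \<union> {C}"
      have S: "x \<in> S \<longleftrightarrow> x = C \<or> x \<in> A ` ({1..k} - {w}) \<or> x \<in> B ` ({1..k} - {i})" for x
        unfolding S_def legs_AB_def by auto
      show False
      proof (rule no_swap[OF _ _ _ _ S_def])
        show "served R S C" using Ci i iw by (intro served_adjI[of _ "A i"]) (auto simp: S)
        fix m assume m: "m \<in> {1..k}"
        show "served R S (A m)"
        proof (cases "m = i")
          case True
          then show ?thesis using symR[OF Ci] by (intro served_adjI[of _ C]) (auto simp: S)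
        next
          case False
          then show ?thesis using leg[OF m] m by (intro served_adjI[of _ "B m"]) (auto simp: S)
        qed
        show "served R S (B m)"
        proof (cases "m = w")
          case True
          then show ?thesis using leg[OF m] symR[OF pair(2)] wu
            by (intro served_twoI[of _ "A w" _ C "A w" "A u"]) (auto simp: S)
        next
          case False
          then show ?thesis using leg[OF m] m by (intro served_adjI[of _ "A m"]) (auto simp: S)
        qed
        show "served R S (L m)"
        proof (cases "m = i")
          case True
          show ?thesis
          proof (cases "z = A w")
            case zw: True
            show ?thesis using z(1) symR[OF pair(2)] wu unfolding True zw
              by (intro served_twoI[of _ "A w" _ C "A w" "A u"]) (auto simp: S)
          next
            case False
            then show ?thesis using zc z(1) unfolding True
              by (intro served_adjI[of _ z]) (auto simp: S)
          qed
        next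
          case False
          then show ?thesis using leg[OF m] m by (intro served_adjI[of _ "B m"]) (auto simp: S)
        qed
      qed (use i wu iw in \<open>auto simp: legs_AB_def leg_verts_def\<close>)
    qed
  qed
qed

text \<open>The two leaves replace \<open>A j\<close>, \<open>B i\<close> and \<open>B j\<close>;
  they serve each other as well as \<open>B i\<close> and \<open>B j\<close>. The vertex
  \<open>A j\<close> is always served, by some \<open>A p\<close> or at two steps by
  \<open>L j\<close> and some \<open>A c\<close>. For \<open>A i\<close> this might depend on the
  dropped \<open>A j\<close>, which \<open>nbr\<close> prevents.\<close>

lemma no_L_L_edge_aux:
  assumes i: "i \<in> {1..k}" and j: "j \<in> {1..k}" and "i \<noteq> j" and LL: "(L i, L j) \<in> R"
    and nbr: "(\<exists>m. m \<noteq> j \<and> adj i m) \<or>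
      (C, A i) \<in> R \<and> (\<exists>m\<in>{1..k}. m \<noteq> i \<and> m \<noteq> j \<and> (C, A m) \<in> R)"
  shows False
proof -
  define S where "S = legs_AB k - {A j, B i, B j} \<union> {L i, L j}"
  have S: "x \<in> S \<longleftrightarrow> x = L i \<or> x = L j \<or> x \<in> A ` ({1..k} - {j}) \<or> x \<in> B ` ({1..k} - {i, j})" for x
    unfolding S_def legs_AB_def by auto
  obtain c where c: "c \<in> {1..k}" "c \<noteq> j" "(C, A c) \<in> R" using C_adj_other by metis
  show False
  proof (rule no_swap[OF _ _ _ _ S_def])
    show "served R S C" using c by (intro served_adjI[of _ "A c"]) (auto simp: S)
    fix m assume m: "m \<in> {1..k}"
    consider "m = i" | "m = j" | "m \<noteq> i" "m \<noteq> j" by blast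
    note cases = this
    from cases show "served R S (L m)"
    proof cases
      case 1
      then show ?thesis using LL by (intro served_adjI[of _ "L j"]) (auto simp: S)
    next
      case 2
      then show ?thesis using symR[OF LL] by (intro served_adjI[of _ "L i"]) (auto simp: S)
    next
      case 3
      then show ?thesis using leg[OF m] m by (intro served_adjI[of _ "B m"]) (auto simp: S)
    qed
    from cases show "served R S (B m)"
    proof cases
      case 1
      then show ?thesis using leg[OF m] by (intro served_adjI[of _ "L i"]) (auto simp: S)
    next
      case 2
      then show ?thesis using leg[OF m] by (intro served_adjI[of _ "L j"]) (auto simp: S)
    next
      case 3
      then show ?thesis using leg[OF m] m by (intro served_adjI[of _ "A m"]) (auto simp: S)
    qed
    from cases show "served R S (A m)"
    proof cases
      case 1
      from nbr show ?thesis
      proof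
        assume "\<exists>m. m \<noteq> j \<and> adj i m"
        then obtain p where "p \<noteq> j" "adj i p" by blast
        then show ?thesis
          using adjD[OF \<open>adj i p\<close>] 1 by (intro served_adjI[of _ "A p"]) (auto simp: S)
      next
        assume *: "(C, A i) \<in> R \<and> (\<exists>m\<in>{1..k}. m \<noteq> i \<and> m \<noteq> j \<and> (C, A m) \<in> R)"
        then obtain p where "p \<in> {1..k}" "p \<noteq> i" "p \<noteq> j" "(C, A p) \<in> R" by blast
        then show ?thesis using 1 leg[OF i] * symR[of C "A i"]
          by (intro served_twoI[of _ "B i" _ "L i" C "A p"]) (auto simp: S)
      qed
    next
      case 2
      show ?thesis
      proof (cases "\<exists>p. adj j p")
        case True
        then obtain p where "adj j p" by blast
        then show ?thesis
          using adjD[OF \<open>adj j p\<close>] 2 by (intro served_adjI[of _ "A p"]) (auto simp: S)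
      next
        case False
        then have "(C, A j) \<in> R" using cut_AC j by blast
        then show ?thesis using 2 leg[OF j] symR[of C "A j"] c
          by (intro served_twoI[of _ "B j" _ "L j" C "A c"]) (auto simp: S)
      qed
    next
      case 3
      then show ?thesis using leg[OF m] m by (intro served_adjI[of _ "B m"]) (auto simp: S)
    qed
  qed (use i j \<open>i \<noteq> j\<close> in \<open>auto simp: legs_AB_def leg_verts_def\<close>)
qed

text \<open>The exchange treats its two legs differently: one keeps its \<open>A\<close>, the other
  loses it. The cases select the orientation in which a third leg or the other end of the pair
  provides \<open>nbr\<close>.\<close>

lemma no_L_L_edge:
  assumes i: "i \<in> {1..k}" and j: "j \<in> {1..k}" and ij: "i \<noteq> j" and LL: "(L i, L j) \<in> R"
  shows False
proof (cases rule: hub_cases)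
  case star
  then have all: "(C, A m) \<in> R" if "m \<in> {1..k}" for m using cut_AC that by blast
  obtain m where "m \<in> {1..k}" "m \<noteq> i" "m \<noteq> j" by (rule third_leg)
  then show False using no_L_L_edge_aux[OF i j ij LL] all i by blast
next
  case (pair w u)
  note wu = adjD[OF pair(1)]
  have out: "(C, A m) \<in> R" if "m \<in> {1..k}" "m \<noteq> w" "m \<noteq> u" for m
    using cut_AC[OF that(1)] not_adj_outside_pair[OF pair(1) that(2,3)] by blast
  have w: False if "p \<in> {1..k}" "q \<in> {1..k}" "p \<noteq> q" "(L p, L q) \<in> R" "p = w" for p q
  proof (cases "q = u")
    case True
    obtain m where "m \<in> {1..k}" "m \<noteq> w" "m \<noteq> u" by (rule third_leg)
    then show False using no_L_L_edge_aux[OF that(1-4)] out pair(2) that(5) True by blast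
  next
    case False
    then have "\<exists>m. m \<noteq> q \<and> adj p m" using pair(1) that(5) by metis
    then show False using no_L_L_edge_aux[OF that(1-4)] by blast
  qed
  have u: False if "p \<in> {1..k}" "q \<in> {1..k}" "p \<noteq> q" "(L p, L q) \<in> R" "p = u" "q \<noteq> w" for p q
  proof -
    have "\<exists>m. m \<noteq> q \<and> adj p m" using adj_sym[OF pair(1)] that(5,6) by metis
    then show False using no_L_L_edge_aux[OF that(1-4)] by blast
  qed
  have LL': "(L j, L i) \<in> R" using symR[OF LL] .
  consider "i = w" | "j = w" | "i = u" "j \<noteq> w" | "j = u" "i \<noteq> w" | "i \<noteq> w" "i \<noteq> u" "j \<noteq> w" "j \<noteq> u"
    by blast
  then show False
  proof cases
    case 1 then show False using w[OF i j ij LL] by blast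
  next
    case 2 then show False using w[OF j i ij[symmetric] LL'] by blast
  next
    case 3 then show False using u[OF i j ij LL] by blast
  next
    case 4 then show False using u[OF j i ij[symmetric] LL'] by blast
  next
    case 5 
    then have "(C, A i) \<in> R" "w \<in> {1..k}" "w \<noteq> i" "w \<noteq> j" using out i wu by auto
    then show False using no_L_L_edge_aux[OF i j ij LL] pair(2) by blast
  qed
qed

text \<open>\<open>B i\<close> is the only vertex that depends on \<open>A i\<close>: the vertices
  \<open>B m\<close> serve all \<open>A m\<close> and \<open>L m\<close>, and they serve
  \<open>C\<close> by \<open>served_C\<close>.\<close>

lemma no_B_edge_plain:
  assumes i: "i \<in> {1..k}" and "served R (legs_AB k - {A i}) (B i)"
  shows False
proof -
  define S where "S = legs_AB k - {A i} \<union> {}"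
  have S: "x \<in> S \<longleftrightarrow> x \<in> B ` {1..k} \<or> x \<in> A ` ({1..k} - {i})" for x
    unfolding S_def legs_AB_def by auto
  show False
  proof (rule no_swap[OF _ _ _ _ S_def])
    show "served R S C" by (rule served_C) (auto simp: S)
    fix m assume m: "m \<in> {1..k}"
    show "served R S (A m)" "served R S (L m)"
      using leg[OF m] m by (auto intro!: served_adjI[of _ "B m"] simp: S)
    show "served R S (B m)"
    proof (cases "m = i")
      case True
      then show ?thesis using assms(2) by (simp add: S_def)
    next
      case False
      then show ?thesis using leg[OF m] m by (intro served_adjI[of _ "A m"]) (auto simp: S)
    qed
  qed (use i in \<open>auto simp: legs_AB_def\<close>)
qed

text \<open>Through \<open>C\<close>, the vertex \<open>B i\<close> reaches further
  \<open>A p\<close>. A star offers two of them; for a leg in the pair, the second one is the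
  partner, reached through \<open>A i\<close>.\<close>

lemma no_B_C_edge:
  assumes i: "i \<in> {1..k}" and BC: "(B i, C) \<in> R"
  shows False
proof (cases rule: hub_cases)
  case star
  obtain p where p: "p \<in> {1..k}" "p \<noteq> i" using third_leg[of i i] by blast
  obtain q where q: "q \<in> {1..k}" "q \<noteq> i" "q \<noteq> p" using third_leg[of i p] by blast
  have "(C, A p) \<in> R" "(C, A q) \<in> R" using cut_AC star p q by blast+
  then show False using BC p q i
    by (intro no_B_edge_plain[OF i] served_twoI[of _ C _ "A p" C "A q"]) (auto simp: legs_AB_def)
next
  case (pair w u)
  note wu = adjD[OF pair(1)]
  show False
  proof (cases "\<exists>j. adj i j")
    case True
    then obtain j where j: "adj i j" by blast
    obtain m where m: "m \<in> {1..k}" "m \<noteq> i" "m \<noteq> j" by (rule third_leg)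
    have "(C, A m) \<in> R" using cut_AC[OF m(1)] not_adj_outside_pair[OF j m(2,3)] by blast
    then show False using BC m i adjD[OF j] leg[OF i]
      by (intro no_B_edge_plain[OF i] served_twoI[of _ C _ "A m" "A i"
        "A j"]) (auto simp: legs_AB_def)
  next
    case False
    then have iw: "i \<noteq> w" "i \<noteq> u" using pair(1) adj_sym[OF pair(1)] by blast+
    \<comment> \<open>Outside the pair, \<open>C\<close> may have no neighbour besides
      \<open>A w\<close> and \<open>A i\<close>. Adding \<open>C\<close> serves \<open>B i\<close>
      directly, and together with \<open>A u\<close> it serves \<open>B w\<close> through
      \<open>A w\<close>.\<close>
    define S where "S = legs_AB k - {A i, A w} \<union> {C}"
    have S: "x \<in> S \<longleftrightarrow> x = C \<or> x \<in> B ` {1..k} \<or> x \<in> A ` ({1..k} - {i, w})" for x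
      unfolding S_def legs_AB_def by auto
    show False
    proof (rule no_swap[OF _ _ _ _ S_def])
      show "served R S C" by (rule served_C) (auto simp: S)
      fix m assume m: "m \<in> {1..k}"
      show "served R S (A m)" "served R S (L m)"
        using leg[OF m] m by (auto intro!: served_adjI[of _ "B m"] simp: S)
      consider "m = i" | "m = w" | "m \<noteq> i" "m \<noteq> w" by blast
      then show "served R S (B m)"
      proof cases
        case 1
        then show ?thesis using BC by (intro served_adjI[of _ C]) (auto simp: S)
      next
        case 2
        then show ?thesis using leg[OF m] symR[OF pair(2)] wu iw
          by (intro served_twoI[of _ "A w" _ C "A w" "A u"]) (auto simp: S)
      next
        case 3
        then show ?thesis using leg[OF m] m by (intro served_adjI[of _ "A m"]) (auto simp: S)
      qed
    qed (use i wu iw in \<open>auto simp: legs_AB_def leg_verts_def\<close>)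
  qed
qed

lemma L_nbr:
  assumes "i \<in> {1..k}" "(L i, z) \<in> R" "z \<in> leg_verts k" "z \<noteq> L i"
  shows "z = B i"
proof (cases z)
  case (L j)
  then have "j \<in> {1..k}" "i \<noteq> j" using assms by (auto simp: leg_verts_def)
  then show ?thesis using no_L_L_edge assms L by blast
qed (use no_L_edge[OF assms(1-3)] in auto)

text \<open>A neighbour \<open>A j\<close> or \<open>B j\<close> of \<open>B i\<close> stays in the
  set when \<open>A i\<close> is dropped; an edge to \<open>L j\<close> is excluded from its leaf
  end.\<close>

lemma B_nbr:
  assumes i: "i \<in> {1..k}" and z: "(B i, z) \<in> R" "z \<in> leg_verts k" "z \<noteq> B i"
  shows "z = A i \<or> z = L i"
proof (rule ccontr)
  assume neg: "\<not> ?thesis"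
  show False
  proof (cases z)
    case C
    then show False using no_B_C_edge i z by blast
  next
    case (A j)
    then show False using z neg
      by (intro no_B_edge_plain[OF i] served_adjI[of _ z]) (auto simp: legs_AB_def leg_verts_def)
  next
    case (B j)
    then show False using z neg
      by (intro no_B_edge_plain[OF i] served_adjI[of _ z]) (auto simp: legs_AB_def leg_verts_def)
  next
    case (L j)
    then have "j \<in> {1..k}" "j \<noteq> i" using z neg by (auto simp: leg_verts_def)
    then show False using L_nbr[of j "B i"] symR[OF z(1)] i L by (auto simp: leg_verts_def)
  qed
qed

end

section \<open>Classification of trees\<close>

definition legged :: "'a set \<Rightarrow> 'a rel \<Rightarrow> bool" where
  "legged V E \<longleftrightarrow> (\<exists>k R f. 2 \<le> k \<and> legs k R \<and> emb f (leg_verts k) R V E)"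

text \<open>\<open>take 8\<close> omits the two small shapes that are already \<open>legged\<close>.
  Each alternative survives the addition of edges, so the type of a spanning tree passes to the
  graph.\<close>

definition tree_type :: "'a set \<Rightarrow> 'a rel \<Rightarrow> bool" where
  "tree_type V E \<longleftrightarrow> (\<exists>Y\<in>set (take 8 small_shapes). shape V E Y) \<or> legged V E \<or> dom_strict V E"

lemma emb_mono: "emb f W R V E \<Longrightarrow> E \<subseteq> E' \<Longrightarrow> emb f W R V E'"
  unfolding emb_def by blast

lemma dom_set_mono: "dom_set V E S \<Longrightarrow> E \<subseteq> E' \<Longrightarrow> dom_set V E' S"
  unfolding dom_set_def using served_mono[OF _ _ subset_refl] by metis

lemma shape_mono: "shape V E Y \<Longrightarrow> E \<subseteq> E' \<Longrightarrow> shape V E' Y"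
  unfolding shape_def using emb_mono by metis

lemma legged_mono: "legged V E \<Longrightarrow> E \<subseteq> E' \<Longrightarrow> legged V E'"
  unfolding legged_def using emb_mono by metis

lemma dom_strict_mono: "dom_strict V E \<Longrightarrow> E \<subseteq> E' \<Longrightarrow> dom_strict V E'"
  unfolding dom_strict_def using dom_set_mono by metis

lemma tree_type_mono: "tree_type V E \<Longrightarrow> E \<subseteq> E' \<Longrightarrow> tree_type V E'"
  unfolding tree_type_def using shape_mono legged_mono dom_strict_mono by metis

lemma leg_verts_2: "leg_verts 2 = {C, A 1, A 2, B 1, B 2, L 1, L 2}"
proof -
  have "{1..2} = {1, 2::nat}" by auto
  then show ?thesis unfolding leg_verts_def by (simp add: insert_commute)
qed

lemma hub_2: "hub 2 = {C, A 1, A 2}"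
proof -
  have "{1..2} = {1, 2::nat}" by auto
  then show ?thesis unfolding hub_def by simp
qed

lemma legged_two_legsI:
  assumes bij: "bij_betw f (leg_verts 2) V" and sym: "sym E"
    and AB: "(f (A 1), f (B 1)) \<in> E" "(f (A 2), f (B 2)) \<in> E"
    and BL: "(f (B 1), f (L 1)) \<in> E" "(f (B 2), f (L 2)) \<in> E"
    and CA: "(f C, f (A 1)) \<in> E" and A2: "(f C, f (A 2)) \<in> E \<or> (f (A 1), f (A 2)) \<in> E"
  shows "legged V E"
proof -
  define R where "R = {(x, y) \<in> leg_verts 2 \<times> leg_verts 2. (f x, f y) \<in> E}"
  have "emb f (leg_verts 2) R V E" using bij by (auto simp: emb_def R_def)
  moreover have "legs 2 R"
  proof
    fix x y assume "(x, y) \<in> R"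
    then show "(y, x) \<in> R" using symD[OF sym, of "f x" "f y"] by (simp add: R_def)
  next
    fix i :: nat assume "i \<in> {1..2}"
    then have "i = 1 \<or> i = 2" by auto
    then show "(A i, B i) \<in> R" "(B i, L i) \<in> R" using AB BL by (auto simp: R_def leg_verts_2)
  next
    fix U assume C: "C \<in> U" and U: "U \<subset> hub 2"
    then have "U \<noteq> {C, A 1, A 2}" "U \<subseteq> {C, A 1, A 2}" unfolding hub_2 by auto
    then have "A 1 \<notin> U \<or> A 1 \<in> U \<and> A 2 \<notin> U" using C by blast
    then show "\<exists>x\<in>U. \<exists>y\<in>hub 2 - U. (x, y) \<in> R"
    proof
      assume "A 1 \<notin> U"
      then show ?thesis
        using C CA by (intro bexI[of _ C] bexI[of _ "A 1"]) (auto simp: R_def leg_verts_2 hub_2)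
    next
      assume A: "A 1 \<in> U \<and> A 2 \<notin> U"
      then have "A 2 \<in> hub 2 - U" by (simp add: hub_2)
      moreover have "(C, A 2) \<in> R \<or> (A 1, A 2) \<in> R" using A2 by (auto simp: R_def leg_verts_2)
      ultimately show ?thesis using A C by blast
    qed
  qed
  ultimately show ?thesis unfolding legged_def by blast
qed

lemma legged_trans: "legged W R \<Longrightarrow> emb f W R V E \<Longrightarrow> legged V E"
  unfolding legged_def using emb_comp by metis

lemma legged_two_legs_verticesI:
  assumes "distinct [c, a1, a2, b1, b2, l1, l2]" "V = {c, a1, a2, b1, b2, l1, l2}" "sym E"
    and "(a1, b1) \<in> E" "(a2, b2) \<in> E" "(b1, l1) \<in> E" "(b2, l2) \<in> E" "(c, a1) \<in> E"
    and "(c, a2) \<in> E \<or> (a1, a2) \<in> E"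
  shows "legged V E"
proof -
  define f where
    "f = case_leg_vertex c (\<lambda>i. if i = 1 then a1 else a2) (\<lambda>i. if i = 1 then b1 else b2)
      (\<lambda>i::nat. if i = 1 then l1 else l2)"
  have f: "f C = c" "f (A 1) = a1" "f (A 2) = a2" "f (B 1) = b1" "f (B 2) = b2" "f (L 1) = l1"
    "f (L 2) = l2"
    by (simp_all add: f_def)
  have "bij_betw f (leg_verts 2) V"
    unfolding bij_betw_def
  proof
    show "inj_on f (leg_verts 2)"
      using assms(1) by (auto simp: leg_verts_2 inj_on_def f[unfolded One_nat_def])
    show "f ` leg_verts 2 = V" unfolding leg_verts_2 image_insert f assms(2) by simp
  qed
  then show ?thesis by (rule legged_two_legsI) (simp_all only: f assms)
qed

lemma sym_sym_edges: "sym (sym_edges es)"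
  by (auto simp: sym_edges_def sym_def)

lemma path_shape_6_7:
  "path_shape 6 = (6, [(0, 1), (1, 2), (2, 3), (3, 4), (4, 5)])"
  "path_shape 7 = (7, [(0, 1), (1, 2), (2, 3), (3, 4), (4, 5), (5, 6)])"
  by (simp_all add: path_shape_def eval_nat_numeral)

text \<open>These are \<open>T_2\<close> and \<open>F_2\<close>. In the latter the extra leaf 6 is
  the center, adjacent only to 2, and the edge between 2 and 3 joins the two legs.\<close>

lemma legged_shapes:
  assumes "X \<in> set (drop 8 small_shapes)"
  shows "legged {..<fst X} (sym_edges (snd X))"
proof -
  consider "X = path_shape 7" | "X = pendant_shape 2 (path_shape 6)"
    using assms by (auto simp: small_shapes_def)
  then show ?thesis
  proof cases
    case 1
    have "{..<7} = {3, 2, 4, 1, 5, 0, 6::nat}" by auto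
    then show ?thesis unfolding 1
      by (intro legged_two_legs_verticesI[of 3 2 4 1 5 0 6])
        (simp_all add: path_shape_6_7 sym_sym_edges, simp_all add: sym_edges_def)
  next
    case 2
    have "{..<7} = {6, 2, 3, 1, 4, 0, 5::nat}" by auto
    then show ?thesis unfolding 2
      by (intro legged_two_legs_verticesI[of 6 2 3 1 4 0 5])
        (simp_all add: path_shape_6_7 pendant_shape_def sym_sym_edges, simp_all add: sym_edges_def)
  qed
qed

lemma tree_type_small:
  assumes "Y \<in> set small_shapes" "shape V E Y"
  shows "tree_type V E"
proof -
  have "set small_shapes = set (take 8 small_shapes) \<union> set (drop 8 small_shapes)"
    by (metis append_take_drop_id set_append)
  then show ?thesis
    using assms legged_shapes legged_trans unfolding tree_type_def shape_def by blast
qed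

lemma dom_weak_small:
  assumes "Y \<in> set (drop 5 (take 8 small_shapes))" "shape V E Y"
  shows "dom_weak V E"
proof -
  have *: "dom_weak {..<fst X} (sym_edges (snd X))"
    if "list_all (\<lambda>s. s < fst X) S" "3 * length S + 2 \<le> 2 * fst X"
      "list_all (served_code (snd X) S) [0..<fst X]" for X S
  proof -
    have "card (set S) \<le> length S" by (rule card_length)
    then show ?thesis
      using that served_code_sound unfolding dom_weak_def dom_set_def
      by (intro exI[of _ "set S"]) (auto simp: list_all_iff)
  qed
  consider "Y = (4, [(0, 1), (0, 2), (0, 3)])" | "Y = pendant_shape 1 (path_shape 6)" |
    "Y = path_shape 4"
    using assms(1) by (auto simp: small_shapes_def)
  then have "dom_weak {..<fst Y} (sym_edges (snd Y))"
  proof cases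
    case 1
    show ?thesis unfolding 1 by (rule *[of _ "[0, 1]"]) code_simp+
  next
    case 2
    show ?thesis unfolding 2 by (rule *[of _ "[1, 2, 3, 4]"]) code_simp+
  next
    case 3
    show ?thesis unfolding 3 by (rule *[of _ "[1, 2]"]) code_simp+
  qed
  then show ?thesis using assms(2) dom_weak_emb unfolding shape_def by blast
qed

text \<open>For reductions that win strictly, the weak bound on the smaller tree suffices; only the
  five violating shapes remain separate.\<close>

lemma tree_type_cases:
  assumes "tree_type V E"
  shows "(\<exists>Y\<in>set (take 5 small_shapes). shape V E Y) \<or> dom_weak V E"
proof -
  have "take 8 small_shapes = take 5 small_shapes @ drop 5 (take 8 small_shapes)"
    by (simp add: small_shapes_def)
  then have
    "set (take 8 small_shapes) = set (take 5 small_shapes) \<union> set (drop 5 (take 8 small_shapes))"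
    by (metis set_append)
  moreover have "dom_weak V E" if "legged V E"
    using that legs.dom_weak dom_weak_emb unfolding legged_def by (metis one_le_numeral order.trans)
  ultimately show ?thesis
    using assms dom_weak_small dom_strict_imp_weak unfolding tree_type_def by blast
qed

lemma tree_type_cert:
  assumes "valid_certs att css" "t < length css" "i < fst (small_shapes ! t)"
    and "shape V E (att i (small_shapes ! t))"
  shows "tree_type V E"
proof -
  have "valid_cert (att i (small_shapes ! t)) (css ! t ! i)"
    using assms(1-3) unfolding valid_certs_def by blast
  from valid_cert_sound[OF assms(4) this] show ?thesis
    using tree_type_small unfolding tree_type_def by blast
qed

lemma tree_type_chain1:
  assumes Y: "Y \<in> set (take 5 small_shapes)" "shape V E' Y"
    and "E' \<subseteq> E" "h \<in> V" "x \<notin> V" "(h, x) \<in> E" "(x, h) \<in> E"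
  shows "tree_type (insert x V) E"
proof -
  obtain t where t: "t < 5" "Y = small_shapes ! t"
    using Y(1) by (metis in_set_conv_nth length_take min_less_iff_conj nth_take)
  obtain n es where ne: "Y = (n, es)" by (cases Y)
  obtain f where f: "emb f {..<n} (sym_edges es) V E'" using Y(2) by (auto simp: shape_def ne)
  obtain i where i: "i < n" "h = f i" using f assms(4) by (auto simp: emb_def bij_betw_def)
  have "emb (f(n := x)) {..<Suc n} (sym_edges ((i, n) # es)) (insert x V) E"
    using emb_pendant_shape[OF f i(1)] assms i by blast
  then have "shape (insert x V) E (pendant_shape i Y)"
    by (auto simp: shape_def ne pendant_shape_def)
  moreover have "t < length chain1_certs" using t by (simp add: chain1_certs_def)
  ultimately show ?thesis using tree_type_cert[OF valid_certs_chain(1)] t i ne by (metis fst_conv)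
qed

lemma tree_type_chain2:
  assumes Y: "Y \<in> set (take 5 small_shapes)" "shape V E' Y"
    and "E' \<subseteq> E" "h \<in> V" "x \<notin> V" "(h, x) \<in> E" "(x, h) \<in> E"
    and "y \<notin> insert x V" "(x, y) \<in> E" "(y, x) \<in> E"
  shows "tree_type (insert y (insert x V)) E"
proof -
  obtain t where t: "t < 5" "Y = small_shapes ! t"
    using Y(1) by (metis in_set_conv_nth length_take min_less_iff_conj nth_take)
  obtain n es where ne: "Y = (n, es)" by (cases Y)
  obtain f where f: "emb f {..<n} (sym_edges es) V E'" using Y(2) by (auto simp: shape_def ne)
  obtain i where i: "i < n" "h = f i" using f assms(4) by (auto simp: emb_def bij_betw_def)
  have "emb (f(n := x)) {..<Suc n} (sym_edges ((i, n) # es)) (insert x V) E"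
    using emb_pendant_shape[OF f i(1)] assms i by blast
  from emb_pendant_shape[OF this, of n y E]
  have "emb (f(n := x, Suc n := y)) {..<Suc (Suc n)} (sym_edges ((n, Suc n) # (i, n) # es))
      (insert y (insert x V)) E" using assms by simp
  then have "shape (insert y (insert x V)) E (pendant_shape (fst Y) (pendant_shape i Y))"
    unfolding shape_def ne pendant_shape_def by auto
  moreover have "t < length chain2_certs" using t by (simp add: chain2_certs_def)
  ultimately show ?thesis using tree_type_cert[OF valid_certs_chain(2)] t i ne by (metis fst_conv)
qed

lemma tree_type_chain3_small:
  assumes Y: "Y \<in> set (take 8 small_shapes)" "shape V E' Y"
    and "E' \<subseteq> E" "h \<in> V" "x \<notin> V" "(h, x) \<in> E" "(x, h) \<in> E"
    and "y \<notin> insert x V" "(x, y) \<in> E" "(y, x) \<in> E"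
    and "z \<notin> insert y (insert x V)" "(y, z) \<in> E" "(z, y) \<in> E"
  shows "tree_type (insert z (insert y (insert x V))) E"
proof -
  obtain t where t: "t < 8" "Y = small_shapes ! t"
    using Y(1) by (metis in_set_conv_nth length_take min_less_iff_conj nth_take)
  obtain n es where ne: "Y = (n, es)" by (cases Y)
  obtain f where f: "emb f {..<n} (sym_edges es) V E'" using Y(2) by (auto simp: shape_def ne)
  obtain i where i: "i < n" "h = f i" using f assms(4) by (auto simp: emb_def bij_betw_def)
  have "emb (f(n := x)) {..<Suc n} (sym_edges ((i, n) # es)) (insert x V) E"
    using emb_pendant_shape[OF f i(1)] assms i by blast
  from emb_pendant_shape[OF this, of n y E]
  have "emb (f(n := x, Suc n := y)) {..<Suc (Suc n)} (sym_edges ((n, Suc n) # (i, n) # es))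
      (insert y (insert x V)) E" using assms by simp
  from emb_pendant_shape[OF this, of "Suc n" z E]
  have "emb (f(n := x, Suc n := y, Suc (Suc n) := z)) {..<Suc (Suc (Suc n))}
      (sym_edges ((Suc n, Suc (Suc n)) # (n, Suc n) # (i, n) # es))
      (insert z (insert y (insert x V))) E" using assms by simp
  then have "shape (insert z (insert y (insert x V))) E
      (pendant_shape (Suc (fst Y)) (pendant_shape (fst Y) (pendant_shape i Y)))"
    unfolding shape_def ne pendant_shape_def by auto
  moreover have "t < length chain3_certs" using t by (simp add: chain3_certs_def)
  ultimately show ?thesis using tree_type_cert[OF valid_certs_chain(3)] t i ne by (metis fst_conv)
qed

text \<open>The new path is labelled as leg \<open>Suc k\<close>. At a hub vertex it really is one
  more leg; at some \<open>B i\<close> or \<open>L i\<close> it permits a saving.\<close>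

lemma tree_type_chain3_legged:
  assumes "legged V E'" "sym E"
    and "E' \<subseteq> E" "h \<in> V" "x \<notin> V" "(h, x) \<in> E"
    and "y \<notin> insert x V" "(x, y) \<in> E"
    and "z \<notin> insert y (insert x V)" "(y, z) \<in> E"
  shows "tree_type (insert z (insert y (insert x V))) E"
proof -
  obtain k R f where k: "2 \<le> k" and "legs k R" and f: "emb f (leg_verts k) R V E'"
    using assms(1) by (auto simp: legged_def)
  interpret legs k R by fact
  let ?V = "insert z (insert y (insert x V))"
  define n where "n = Suc k"
  define g where "g = f(A n := x, B n := y, L n := z)"
  obtain w where w: "w \<in> leg_verts k" "f w = h"
    using f assms(4) by (auto simp: emb_def bij_betw_def)
  define R' where "R' = {(u, v) \<in> leg_verts n \<times> leg_verts n. (g u, g v) \<in> E}"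
  have leg_n: "leg_verts n = insert (L n) (insert (B n) (insert (A n) (leg_verts k)))"
  proof -
    have "{1..n} = insert n {1..k}" by (auto simp: n_def)
    then show ?thesis unfolding leg_verts_def by auto
  qed
  have new: "A n \<notin> leg_verts k" "B n \<notin> leg_verts k" "L n \<notin> leg_verts k"
    by (auto simp: leg_verts_def n_def)
  have gf: "g u = f u" if "u \<in> leg_verts k" for u
    using that new by (auto simp: g_def)
  have bij: "bij_betw f (leg_verts k) V" and RE: "\<And>u v. (u, v) \<in> R \<Longrightarrow> (f u, f v) \<in> E"
    and RW: "R \<subseteq> leg_verts k \<times> leg_verts k"
    using f assms(3) by (auto simp: emb_def)
  have "bij_betw g (leg_verts n) ?V"
    unfolding bij_betw_def
  proof
    have img: "g ` leg_verts k = V" using bij gf by (simp add: bij_betw_def)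
    have inj: "inj_on g (leg_verts k)" using bij gf by (simp add: bij_betw_def inj_on_def)
    have gn: "g (A n) = x" "g (B n) = y" "g (L n) = z" by (simp_all add: g_def)
    show "g ` leg_verts n = ?V" unfolding leg_n image_insert img gn ..
    show "inj_on g (leg_verts n)"
      unfolding leg_n inj_on_insert using inj assms new by (simp add: img gn insert_Diff_if)
  qed
  then have emb: "emb g (leg_verts n) R' ?V E" by (auto simp: emb_def R'_def)
  have symR': "(v, u) \<in> R'" if "(u, v) \<in> R'" for u v
    using that symD[OF assms(2), of "g u" "g v"] by (simp add: R'_def)
  have sub: "R \<subseteq> R'"
  proof (rule subrelI)
    fix u v assume uv: "(u, v) \<in> R"
    then have "u \<in> leg_verts k" "v \<in> leg_verts k" using RW by auto
    then show "(u, v) \<in> R'" using RE[OF uv] gf leg_n by (simp add: R'_def)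
  qed
  have ab: "(A (Suc k), B (Suc k)) \<in> R'" "(B (Suc k), L (Suc k)) \<in> R'"
    using assms unfolding R'_def leg_n unfolding n_def[symmetric] by (auto simp: g_def)
  have wa: "(w, A (Suc k)) \<in> R'"
    using assms w gf[OF w(1)]
      unfolding R'_def leg_n unfolding n_def[symmetric] by (auto simp: g_def)
  consider "w \<in> hub k" | i where "i \<in> {1..k}" "w = B i" | i where "i \<in> {1..k}" "w = L i"
    using w(1) by (auto simp: leg_verts_def hub_def)
  then have "legs n R' \<or> dom_strict (leg_verts n) R'"
  proof cases
    case 1
    then show ?thesis using legs_Suc[OF symR' sub ab _ wa] by (simp add: n_def)
  next
    case (2 i)
    then show ?thesis using dom_strict_Suc_B[OF symR' sub ab] wa k by (simp add: n_def)
  next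
    case (3 i)
    then show ?thesis using dom_strict_Suc_L[OF symR' sub ab] wa k by (simp add: n_def)
  qed
  then show ?thesis
  proof
    assume "legs n R'"
    moreover have "2 \<le> n" using k by (simp add: n_def)
    ultimately have "legged ?V E" unfolding legged_def using emb by blast
    then show ?thesis by (simp add: tree_type_def)
  next
    assume "dom_strict (leg_verts n) R'"
    then have "dom_strict ?V E" using dom_strict_emb[OF emb] by blast
    then show ?thesis by (simp add: tree_type_def)
  qed
qed

section \<open>Extending dominating sets to the removed vertices\<close>

text \<open>Everything that serves the leaf \<open>y\<close> comes from or through \<open>p\<close>,
  and so it serves the new leaf \<open>x\<close> too.\<close>

lemma dom_set_twin_leaf:
  assumes S: "dom_set V E' S" and "E' \<subseteq> E" and y: "y \<in> V" "\<And>s. (y, s) \<in> E' \<Longrightarrow> s = p"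
    and x: "x \<notin> V" "(x, p) \<in> E"
  shows "dom_set (insert x V) E S"
proof -
  have SV: "S \<subseteq> V" using S by (simp add: dom_set_def)
  have "served E' S y" using S y by (simp add: dom_set_def)
  then consider s where "s \<in> S" "(y, s) \<in> E'"
    | s t u v where "s \<in> S" "t \<in> S" "s \<noteq> t" "(y, u) \<in> E'" "(u, s) \<in> E'" "(y, v) \<in> E'" "(v, t) \<in> E'"
    unfolding served_def by blast
  then have "served E S x"
  proof cases
    case 1
    then show ?thesis using y(2) x by (blast intro: served_adjI)
  next
    case 2
    then have "u = p" "v = p" using y(2) by blast+
    moreover have "s \<noteq> x" "t \<noteq> x" using 2 SV x by blast+
    ultimately show ?thesis using 2 x \<open>E' \<subseteq> E\<close> by (intro served_twoI[of x p _ s p t]) auto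
  qed
  then show ?thesis using S \<open>E' \<subseteq> E\<close> SV unfolding dom_set_def by (auto intro: served_mono)
qed

text \<open>Two steps away from \<open>q\<close> lies at most the single vertex \<open>h\<close>,
  whereas service from there takes two.\<close>

lemma leaf_support_in_dom_set:
  assumes S: "dom_set V E S" and q: "q \<in> V" "\<And>s. (q, s) \<in> E \<Longrightarrow> s = g"
    and g: "\<And>s. (g, s) \<in> E \<Longrightarrow> s = q \<or> s = h"
  shows "g \<in> S"
proof -
  have "served E S q" using S q by (simp add: dom_set_def)
  then consider s where "s \<in> S" "(q, s) \<in> E"
    | s t u v where "s \<noteq> t" "s \<noteq> q" "t \<noteq> q" "(q, u) \<in> E" "(u, s) \<in> E" "(q, v) \<in> E" "(v, t) \<in> E"
    unfolding served_def by blast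
  then show ?thesis
  proof cases
    case 1
    then show ?thesis using q by blast
  next
    case 2
    then have "u = g" "v = g" using q by blast+
    then have "s = h" "t = h" using 2 g by blast+
    then show ?thesis using 2 by blast
  qed
qed

text \<open>\<open>v\<close> hangs on \<open>p\<close>, so the one new vertex \<open>p\<close>
  suffices as soon as \<open>p\<close> itself is served.\<close>

lemma dom_set_pendant_P2:
  assumes S: "dom_set V E' S" "finite V" and "E' \<subseteq> E"
    and "p \<notin> V" "v \<notin> V" "(v, p) \<in> E" and p: "served E (insert p S) p"
  shows "\<exists>T. dom_set (insert v (insert p V)) E T \<and> card T \<le> card S + 1"
proof (intro exI conjI)
  show "dom_set (insert v (insert p V)) E (insert p S)"
    using assms unfolding dom_set_def
    by (auto intro: served_mono[of E' S] served_adjI[of v p])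
  show "card (insert p S) \<le> card S + 1"
    using S finite_subset[of S V] by (simp add: dom_set_def card_insert_if)
qed

lemma dom_set_pendant_P2_leaf:
  assumes S: "dom_set V E' S" "finite V" and "E' \<subseteq> E"
    and "p \<notin> V" "v \<notin> V" "(v, p) \<in> E" "(p, g) \<in> E"
    and q: "q \<in> V" "\<And>s. (q, s) \<in> E' \<Longrightarrow> s = g" and g: "\<And>s. (g, s) \<in> E' \<Longrightarrow> s = q \<or> s = h"
  shows "\<exists>T. dom_set (insert v (insert p V)) E T \<and> card T \<le> card S + 1"
proof (rule dom_set_pendant_P2[OF S \<open>E' \<subseteq> E\<close>])
  have "g \<in> S" by (rule leaf_support_in_dom_set[OF S(1) q g])
  then show "served E (insert p S) p" using assms by (intro served_adjI[of p g]) auto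
qed (use assms in auto)

text \<open>The parallel path \<open>g\<close>, \<open>q\<close>, \<open>w\<close> forces
  \<open>q\<close> into the set. Whatever serves \<open>q\<close> from the side of \<open>g\<close>
  also serves \<open>p\<close>; the only obstacle is that \<open>w\<close> may be what serves
  \<open>q\<close>.\<close>

lemma dom_set_pendant_P2_twin:
  assumes S: "dom_set V E' S" "finite V" and "E' \<subseteq> E" and "sym E'"
    and "p \<notin> V" "v \<notin> V" "(v, p) \<in> E" "(p, g) \<in> E"
    and w: "w \<in> V" "\<And>s. (w, s) \<in> E' \<Longrightarrow> s = q" and q: "q \<in> V" "\<And>s. (q, s) \<in> E' \<Longrightarrow> s = w \<or> s = g"
    and "g \<in> V" "(q, g) \<in> E'" "(w, q) \<in> E'" "g \<noteq> w"
  shows "\<exists>T. dom_set (insert v (insert p V)) E T \<and> card T \<le> card S + 1"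
proof -
  have "q \<in> S" by (rule leaf_support_in_dom_set[OF S(1) w q(2)])
  have SV: "S \<subseteq> V" using S by (simp add: dom_set_def)
  have symE': "(b, a) \<in> E'" if "(a, b) \<in> E'" for a b using \<open>sym E'\<close> that by (rule symD)
  \<comment> \<open>If \<open>w\<close> serves \<open>q\<close>, then \<open>g\<close> can do so instead.\<close>
  consider "g \<in> S" | "g \<notin> S" "w \<in> S" | "g \<notin> S" "w \<notin> S" by blast
  then show ?thesis
  proof cases
    case 1
    then show ?thesis
      by (intro dom_set_pendant_P2[OF S \<open>E' \<subseteq> E\<close> \<open>p \<notin> V\<close> \<open>v \<notin> V\<close> \<open>(v, p) \<in> E\<close>]
          served_adjI[OF \<open>(p, g) \<in> E\<close>]) simp
  next
    case 2
    let ?S = "insert g (S - {w})"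
    have "q \<noteq> w" using w(2)[of g] \<open>(q, g) \<in> E'\<close> \<open>g \<noteq> w\<close> by auto
    then have "q \<in> ?S" using \<open>q \<in> S\<close> by simp
    have served: "served E' ?S u" if u: "u \<in> V" for u
    proof (cases "u = q \<or> u = g \<or> u = w")
      case True
      then show ?thesis
        using served_adjI[OF \<open>(q, g) \<in> E'\<close>, of ?S] served_adjI[OF \<open>(w, q) \<in> E'\<close> \<open>q \<in> ?S\<close>]
          served_adjI[OF symE'[OF \<open>(q, g) \<in> E'\<close>] \<open>q \<in> ?S\<close>] by auto
    next
      case False
      have "(u, w) \<notin> E'" using w(2)[of u] symE'[of u w] False by auto
      moreover have "(u, w) \<notin> E' O E'"
      proof
        assume "(u, w) \<in> E' O E'"
        then obtain a where a: "(u, a) \<in> E'" "(a, w) \<in> E'" by blast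
        then have "a = q" using w(2)[OF symE'[OF a(2)]] by simp
        then show False using q(2)[of u] symE'[OF a(1)] False by auto
      qed
      moreover have "served E' S u" using S u by (simp add: dom_set_def)
      ultimately show ?thesis unfolding served_def by blast
    qed
    have dom: "dom_set V E' ?S" using served SV \<open>g \<in> V\<close> by (auto simp: dom_set_def)
    have "finite S" using S SV finite_subset by blast
    then have "card ?S = card S" using 2 card_gt_0_iff[of S] by auto
    moreover have "\<exists>T. dom_set (insert v (insert p V)) E T \<and> card T \<le> card ?S + 1"
      by (intro dom_set_pendant_P2[OF dom S(2) \<open>E' \<subseteq> E\<close> \<open>p \<notin> V\<close> \<open>v \<notin> V\<close> \<open>(v, p) \<in> E\<close>]
          served_adjI[OF \<open>(p, g) \<in> E\<close>]) simp
    ultimately show ?thesis by simp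
  next
    case 3
    have "served E' S q" using S q by (simp add: dom_set_def)
    moreover have "\<not> (\<exists>s\<in>S. (q, s) \<in> E')" using 3 q(2) by blast
    ultimately obtain s t a b where st: "s \<in> S" "t \<in> S" "s \<noteq> t" "s \<noteq> q" "t \<noteq> q"
        "(q, a) \<in> E'" "(a, s) \<in> E'" "(q, b) \<in> E'" "(b, t) \<in> E'"
      unfolding served_def by blast
    have "a = g" "b = g"
      using q(2)[OF st(6)] q(2)[OF st(8)] w(2)[of s] w(2)[of t] st by auto
    moreover have "s \<noteq> p" "t \<noteq> p" using st SV \<open>p \<notin> V\<close> by blast+
    ultimately show ?thesis using st \<open>E' \<subseteq> E\<close> \<open>(p, g) \<in> E\<close>
      by (intro dom_set_pendant_P2[OF S \<open>E' \<subseteq> E\<close> \<open>p \<notin> V\<close> \<open>v \<notin> V\<close> \<open>(v, p) \<in> E\<close>]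
          served_twoI[of p g _ s g t]) auto
  qed
qed

lemma dom_set_pendant_P3:
  assumes S: "dom_set V E' S" "finite V" and "E' \<subseteq> E"
    and "x \<notin> V" "y \<notin> V" "z \<notin> V" "(x, y) \<in> E" "(y, x) \<in> E" "(z, y) \<in> E"
  shows "\<exists>T. dom_set (insert z (insert y (insert x V))) E T \<and> card T \<le> card S + 2"
proof (intro exI conjI)
  show "dom_set (insert z (insert y (insert x V))) E (insert x (insert y S))"
    using assms unfolding dom_set_def
    by (auto intro: served_mono[of E' S] served_adjI[of z y] served_adjI[of y x]
        served_adjI[of x y])
  show "card (insert x (insert y S)) \<le> card S + 2"
    using S finite_subset[of S V] by (simp add: dom_set_def card_insert_if)
qed

section \<open>Rooted trees and the induction\<close>

text \<open>A depth that grows along parent pointers excludes cycles without any notion of path. A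
  set closed under children can be removed with \<open>par\<close> and \<open>d\<close> unchanged,
  so the induction varies the vertex set only. The depth of the root may be any number.\<close>

definition rtree :: "'a set \<Rightarrow> 'a \<Rightarrow> ('a \<Rightarrow> 'a) \<Rightarrow> ('a \<Rightarrow> nat) \<Rightarrow> bool" where
  "rtree V r par d \<longleftrightarrow> finite V \<and> r \<in> V \<and> (\<forall>v\<in>V - {r}. par v \<in> V \<and> d v = Suc (d (par v)))"

definition tree_edges :: "'a set \<Rightarrow> 'a \<Rightarrow> ('a \<Rightarrow> 'a) \<Rightarrow> 'a rel" where
  "tree_edges V r par = {(x, y). x \<in> V - {r} \<and> y = par x \<or> y \<in> V - {r} \<and> x = par y}"

lemma rtree_Diff:
  assumes "rtree V r par d" "r \<notin> W" "\<And>u. u \<in> V - {r} \<Longrightarrow> par u \<in> W \<Longrightarrow> u \<in> W"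
  shows "rtree (V - W) r par d"
  using assms unfolding rtree_def by auto

lemma tree_edges_mono: "V' \<subseteq> V \<Longrightarrow> tree_edges V' r par \<subseteq> tree_edges V r par"
  unfolding tree_edges_def by auto

lemma sym_tree_edges: "sym (tree_edges V r par)"
  unfolding tree_edges_def sym_def by auto

lemma tree_edgesI:
  "v \<in> V - {r} \<Longrightarrow> (v, par v) \<in> tree_edges V r par"
  "v \<in> V - {r} \<Longrightarrow> (par v, v) \<in> tree_edges V r par"
  unfolding tree_edges_def by auto

lemma rtree_depth:
  assumes "rtree V r par d" "u \<in> V" "u \<noteq> r"
  shows "d r < d u"
  using assms(2,3)
proof (induction "d u" arbitrary: u rule: less_induct)
  case less
  then have "par u \<in> V" "d u = Suc (d (par u))" using assms(1) by (auto simp: rtree_def)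
  then show ?case using less.hyps[of "par u"] by (cases "par u = r") auto
qed

lemma shape_singleton: "shape {r} E (path_shape 1)"
  unfolding shape_def by (intro exI[of _ "\<lambda>_. r"])
    (auto simp: emb_def path_shape_def sym_edges_def bij_betw_def lessThan_Suc)

lemma path_shape_1_small: "path_shape 1 \<in> set (take 5 small_shapes)"
  by (simp add: small_shapes_def)

text \<open>This step wins nothing, so each alternative of the type has to be carried over
  separately.\<close>

lemma tree_type_chain3:
  assumes "tree_type V E'" "finite V" "sym E"
    and "E' \<subseteq> E" "h \<in> V" "x \<notin> V" "(h, x) \<in> E"
    and "y \<notin> insert x V" "(x, y) \<in> E"
    and "z \<notin> insert y (insert x V)" "(y, z) \<in> E"
  shows "tree_type (insert z (insert y (insert x V))) E"
proof -
  have bk: "(x, h) \<in> E" "(y, x) \<in> E" "(z, y) \<in> E"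
    using symD[OF assms(3)] assms(7,9,11) by blast+
  from assms(1) consider Y where "Y \<in> set (take 8 small_shapes)" "shape V E' Y"
    | "legged V E'" | "dom_strict V E'"
    unfolding tree_type_def by blast
  then show ?thesis
  proof cases
    case 1
    then show ?thesis using assms(4-11) bk by (intro tree_type_chain3_small[of Y V E' E h])
  next
    case 2
    then show ?thesis by (rule tree_type_chain3_legged) (use assms in simp_all)
  next
    case 3
    then obtain S where S: "dom_set V E' S" "3 * card S + 2 < 2 * card V"
      by (auto simp: dom_strict_def)
    obtain T where T: "dom_set (insert z (insert y (insert x V))) E T" "card T \<le> card S + 2"
      using dom_set_pendant_P3[OF S(1) assms(2,4), of x y z] assms bk by auto
    have "card (insert z (insert y (insert x V))) = card V + 3" using assms by simp
    then have "3 * card T + 2 < 2 * card (insert z (insert y (insert x V)))" using S T by simp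
    then show ?thesis using T by (auto simp: tree_type_def dom_strict_def)
  qed
qed

lemma tree_type_pendant_P2:
  assumes "tree_type V E'" "finite V" "sym E"
    and "E' \<subseteq> E" "g \<in> V" "p \<notin> V" "(g, p) \<in> E" "v \<notin> insert p V" "(p, v) \<in> E"
    and ext: "\<And>S. dom_set V E' S \<Longrightarrow> \<exists>T. dom_set (insert v (insert p V)) E T \<and> card T \<le> card S + 1"
  shows "tree_type (insert v (insert p V)) E"
proof -
  have bk: "(p, g) \<in> E" "(v, p) \<in> E" using symD[OF assms(3)] assms(7,9) by blast+
  from tree_type_cases[OF assms(1)] show ?thesis
  proof
    assume "\<exists>Y\<in>set (take 5 small_shapes). shape V E' Y"
    then obtain Y where "Y \<in> set (take 5 small_shapes)" "shape V E' Y" by blast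
    then show ?thesis using assms(4-9) bk by (intro tree_type_chain2[of Y V E' E g])
  next
    assume "dom_weak V E'"
    then obtain S where S: "dom_set V E' S" "3 * card S + 2 \<le> 2 * card V"
      by (auto simp: dom_weak_def)
    obtain T where T: "dom_set (insert v (insert p V)) E T" "card T \<le> card S + 1"
      using ext[OF S(1)] by blast
    have "card (insert v (insert p V)) = card V + 2" using assms by simp
    then have "3 * card T + 2 < 2 * card (insert v (insert p V))" using S T by simp
    then show ?thesis using T by (auto simp: tree_type_def dom_strict_def)
  qed
qed

lemma tree_type_twin_leaf:
  assumes "tree_type V E'" "finite V" "sym E"
    and "E' \<subseteq> E" "p \<in> V" "x \<notin> V" "(p, x) \<in> E" "y \<in> V" "\<And>s. (y, s) \<in> E' \<Longrightarrow> s = p"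
  shows "tree_type (insert x V) E"
proof -
  have bk: "(x, p) \<in> E" using symD[OF assms(3)] assms(7) by blast
  from tree_type_cases[OF assms(1)] show ?thesis
  proof
    assume "\<exists>Y\<in>set (take 5 small_shapes). shape V E' Y"
    then obtain Y where "Y \<in> set (take 5 small_shapes)" "shape V E' Y" by blast
    then show ?thesis using assms(4-7) bk by (intro tree_type_chain1[of Y V E' E p])
  next
    assume "dom_weak V E'"
    then obtain S where S: "dom_set V E' S" "3 * card S + 2 \<le> 2 * card V"
      by (auto simp: dom_weak_def)
    have "dom_set (insert x V) E S" by (rule dom_set_twin_leaf[OF S(1) assms(4,8,9,6) bk])
    moreover have "3 * card S + 2 < 2 * card (insert x V)" using S assms by simp
    ultimately show ?thesis by (auto simp: tree_type_def dom_strict_def)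
  qed
qed

text \<open>The root is never removed. Where the path from a deepest vertex reaches it too early,
  the tree has two or three vertices and is read off the certificates.\<close>

lemma tree_type_rtree:
  assumes "rtree V r par d"
  shows "tree_type V (tree_edges V r par)"
  using assms
proof (induction "card V" arbitrary: V rule: less_induct)
  case less
  note T = less.prems
  let ?E = "tree_edges V r par"
  define ch where "ch x = {u \<in> V - {r}. par u = x}" for x
  have fin: "finite V" and rV: "r \<in> V" and par: "\<And>v. v \<in> V - {r} \<Longrightarrow> par v \<in> V"
    and d: "\<And>v. v \<in> V - {r} \<Longrightarrow> d v = Suc (d (par v))"
    using T by (auto simp: rtree_def)
  have IH: "tree_type (V - W) (tree_edges (V - W) r par)"
    if "r \<notin> W" "\<And>u. u \<in> V - {r} \<Longrightarrow> par u \<in> W \<Longrightarrow> u \<in> W" "x \<in> W" "x \<in> V" for W x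
  proof -
    have "rtree (V - W) r par d" using rtree_Diff[OF T] that by blast
    moreover have "card (V - W) < card V" using fin that by (intro psubset_card_mono) auto
    ultimately show ?thesis using less.hyps by blast
  qed
  have sub: "tree_edges (V - W) r par \<subseteq> ?E" for W by (intro tree_edges_mono) blast
  have par_neq: "par v \<noteq> v" if "v \<in> V - {r}" for v using d[OF that] by (metis n_not_Suc_n)
  show ?case
  proof (cases "\<exists>x y. x \<noteq> y \<and> x \<in> V - {r} \<and> y \<in> V - {r} \<and> par x = par y \<and> ch x = {} \<and> ch y = {}")
    case True
    then obtain x y where xy: "x \<noteq> y" "x \<in> V - {r}" "y \<in> V - {r}" "par x = par y" "ch x = {}"
      "ch y = {}"
      by blast
    have "tree_type (V - {x}) (tree_edges (V - {x}) r par)"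
      using xy by (intro IH[of _ x]) (auto simp: ch_def)
    moreover have "par x \<noteq> x" using par_neq xy by blast
    moreover have "s = par x" if "(y, s) \<in> tree_edges (V - {x}) r par" for s
      using that xy unfolding tree_edges_def ch_def by auto
    ultimately have "tree_type (insert x (V - {x})) ?E"
      using fin xy par sub[of "{x}"] tree_edgesI[of x V r par] sym_tree_edges[of V r par]
      by (intro tree_type_twin_leaf[of "V - {x}" "tree_edges (V - {x}) r par" _ "par x" _ y]) auto
    moreover have "insert x (V - {x}) = V" using xy by blast
    ultimately show ?thesis by simp
  next
    case noA: False
    show ?thesis
    proof (cases "V = {r}")
      case True
      have "path_shape 1 \<in> set small_shapes" using path_shape_1_small set_take_subset by fast
      from tree_type_small[OF this shape_singleton] show ?thesis by (simp add: True)
    next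
      case False
      have "Max (d ` V) \<in> d ` V" using fin rV by (intro Max_in) auto
      then obtain v where vV: "v \<in> V" and "d v = Max (d ` V)" by auto
      then have vmax: "d u \<le> d v" if "u \<in> V" for u using fin that by simp
      have "v \<noteq> r"
      proof
        assume "v = r"
        obtain u where "u \<in> V" "u \<noteq> r" using False rV by blast
        then show False using rtree_depth[OF T] vmax \<open>v = r\<close> by (metis not_le)
      qed
      then have v: "v \<in> V - {r}" using vV by blast
      have leaf: "ch u = {}" if "d u = d v" for u
      proof -
        have False if "w \<in> ch u" for w
        proof -
          have w: "w \<in> V - {r}" "par w = u" using that by (auto simp: ch_def)
          then show False using d[OF w(1)] vmax[of w] \<open>d u = d v\<close> by simp
        qed
        then show ?thesis by blast
      qed
      define p where "p = par v"
      have pV: "p \<in> V" and dv: "d v = Suc (d p)" using par[OF v] d[OF v] by (simp_all add: p_def)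
      \<comment> \<open>Vertices as deep as \<open>v\<close> have no children; a second child of
        \<open>x\<close> would be equally deep and give two leaves with a common parent.\<close>
      have only: "ch x = {u}" if "u \<in> ch x" "d u = d v" for x u
      proof -
        have "u' = u" if "u' \<in> ch x" for u'
        proof (rule ccontr)
          assume "u' \<noteq> u"
          have u: "u \<in> V - {r}" "u' \<in> V - {r}" "par u = x" "par u' = x"
            using that \<open>u \<in> ch x\<close> by (auto simp: ch_def)
          then have "d u' = d u" using d[of u] d[of u'] by simp
          then have "ch u = {}" "ch u' = {}" using leaf \<open>d u = d v\<close> by auto
          then show False using noA u \<open>u' \<noteq> u\<close> by metis
        qed
        then show ?thesis using that by blast
      qed
      have chp: "ch p = {v}" using only[of v p] v by (simp add: ch_def p_def)
      have pv: "p \<noteq> v" using par_neq v by (simp add: p_def)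
      have Epv: "(p, v) \<in> ?E" "(v, p) \<in> ?E" using tree_edgesI[OF v, of par] by (simp_all add: p_def)
      show ?thesis
      proof (cases "p = r")
        case pr: True
        have "V = insert v {r}"
        proof -
          have "u = v" if "u \<in> V" "u \<noteq> r" for u
          proof -
            have "par u = r"
            proof (rule ccontr)
              assume "par u \<noteq> r"
              then have "d r < d (par u)" using rtree_depth[OF T] par that by blast
              then have "d v < d u" using d[of u] that dv pr by simp
              then show False using vmax that by (metis not_le)
            qed
            then have "u \<in> ch p" using that pr by (simp add: ch_def)
            then show ?thesis using chp by blast
          qed
          then show ?thesis using v rV by blast
        qed
        moreover have "tree_type (insert v {r}) ?E"
          using tree_type_chain1[OF path_shape_1_small shape_singleton, of "{}" ?E r r v] Epv pr v
            by auto
        ultimately show ?thesis by simp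
      next
        case pr: False
        define g where "g = par p"
        have p: "p \<in> V - {r}" using pV pr by blast
        have gV: "g \<in> V" and dp: "d p = Suc (d g)" using par[OF p] d[OF p] by (simp_all add: g_def)
        have gp: "g \<noteq> p" using par_neq p by (simp add: g_def)
        have gv: "g \<noteq> v" using dv dp by auto
        have Egp: "(g, p) \<in> ?E" "(p, g) \<in> ?E"
          using tree_edgesI[OF p, of par] by (simp_all add: g_def)
        have pch: "p \<in> ch g" using p by (simp add: ch_def g_def)
        have chv: "ch v = {}" using leaf by blast
        have V2: "insert v (insert p (V - {p, v})) = V" using v p by blast
        let ?E2 = "tree_edges (V - {p, v}) r par"
        have closed2: "u \<in> {p, v}" if "u \<in> V - {r}" "par u \<in> {p, v}" for u
          using that chp chv unfolding ch_def by blast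
        have type2: "tree_type (V - {p, v}) ?E2"
          using pr v closed2 p by (intro IH[of _ p]) auto
        have reduce2: ?thesis if "\<And>S. dom_set (V - {p, v}) ?E2 S \<Longrightarrow>
            \<exists>T. dom_set (insert v (insert p (V - {p, v}))) ?E T \<and> card T \<le> card S + 1"
        proof -
          have "tree_type (insert v (insert p (V - {p, v}))) ?E"
            using that type2 fin sub[of "{p, v}"] gV gp gv Egp Epv pv sym_tree_edges[of V r par]
            by (intro tree_type_pendant_P2[of "V - {p, v}" ?E2 _ g]) auto
          then show ?thesis unfolding V2 .
        qed
        \<comment> \<open>Every other child of \<open>g\<close> is as deep as \<open>p\<close>, so
          it is a leaf or begins a path of two vertices parallel to \<open>p\<close>,
          \<open>v\<close>.\<close>
        show ?thesis
        proof (cases "\<exists>q\<in>ch g. q \<noteq> p \<and> ch q \<noteq> {}")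
          case True
          then obtain q w where q: "q \<in> ch g" "q \<noteq> p" and w: "w \<in> ch q" by blast
          have dq: "d q = d p" using q d[of q] dp by (simp add: ch_def)
          have dw: "d w = d v" using w d[of w] dq dv by (simp add: ch_def)
          have chq: "ch q = {w}" using only[OF w dw] .
          have chw: "ch w = {}" using leaf[OF dw] .
          have qV: "q \<in> V - {r}" "par q = g" and wV: "w \<in> V - {r}" "par w = q"
            using q w by (auto simp: ch_def)
          have ne: "q \<noteq> v" "w \<noteq> p" "w \<noteq> v" "g \<noteq> w" "g \<noteq> q"
            using dq dw dv dp wV q(2) by (auto simp: p_def)
          show ?thesis
          proof (rule reduce2)
            fix S assume S: "dom_set (V - {p, v}) ?E2 S"
            show "\<exists>T. dom_set (insert v (insert p (V - {p, v}))) ?E T \<and> card T \<le> card S + 1"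
            proof (rule dom_set_pendant_P2_twin[OF S _ sub sym_tree_edges, of _ _ g w q])
              show "s = q" if "(w, s) \<in> ?E2" for s
                using that wV chw by (auto simp: tree_edges_def ch_def)
              show "s = w \<or> s = g" if "(q, s) \<in> ?E2" for s
                using that qV chq by (auto simp: tree_edges_def ch_def)
              show "(q, g) \<in> ?E2" "(w, q) \<in> ?E2"
                using qV wV q(2) ne by (auto simp: tree_edges_def)
            qed (use fin Epv Egp qV wV ne gV gp gv q(2) in auto)
          qed
        next
          case noB: False
          show ?thesis
          proof (cases "ch g = {p}")
            case False
            then obtain q where q: "q \<in> ch g" "q \<noteq> p" using pch by blast
            have qV: "q \<in> V - {r}" "par q = g" using q by (auto simp: ch_def)
            have chq: "ch q = {}" using noB q by blast
            \<comment> \<open>Two such leaves were treated before. Without \<open>p\<close> and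
              \<open>v\<close>, the vertex \<open>g\<close> keeps only \<open>q\<close> and possibly
              its parent as neighbours, so \<open>q\<close> forces \<open>g\<close> into the
              set.\<close>
            have other: "q' = q" if "q' \<in> ch g" "q' \<noteq> p" for q'
            proof (rule ccontr)
              assume "q' \<noteq> q"
              moreover have "q' \<in> V - {r}" "par q' = g" using that by (auto simp: ch_def)
              moreover have "ch q' = {}" using noB that by blast
              ultimately show False using noA qV chq by metis
            qed
            have ne: "q \<noteq> v" using qV gp dv dp d[of q] by auto
            show ?thesis
            proof (rule reduce2)
              fix S assume S: "dom_set (V - {p, v}) ?E2 S"
              show "\<exists>T. dom_set (insert v (insert p (V - {p, v}))) ?E T \<and> card T \<le> card S + 1"
              \<comment> \<open>If \<open>g\<close> is the root, \<open>par g\<close> is an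
                arbitrary vertex, which merely weakens the condition on the neighbours of
                \<open>g\<close>.\<close>
              proof (rule dom_set_pendant_P2_leaf[OF S _ sub, of _ _ g q "par g"])
                show "s = g" if "(q, s) \<in> ?E2" for s
                  using that qV chq by (auto simp: tree_edges_def ch_def)
                show "s = q \<or> s = par g" if "(g, s) \<in> ?E2" for s
                  using that other by (auto simp: tree_edges_def ch_def)
              qed (use fin Epv Egp qV q(2) ne in auto)
            qed
          next
            case chg: True
            show ?thesis
            proof (cases "g = r")
              case gr: True
              have "V = insert v (insert p {r})"
              proof -
                have "u = v \<or> u = p" if u: "u \<in> V" "u \<noteq> r" for u
                proof (cases "par u = r")
                  case True
                  then have "u \<in> ch g" using u gr by (simp add: ch_def)
                  then show ?thesis using chg by blast
                next
                  case False
                  have pu: "par u \<in> V - {r}" using False par u by blast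
                  have "par (par u) = r"
                  proof (rule ccontr)
                    assume "par (par u) \<noteq> r"
                    then have "d r < d (par (par u))" using rtree_depth[OF T] par pu by blast
                    then have "d v < d u" using d[of u] d[OF pu] u dv dp gr by simp
                    then show False using vmax u by (metis not_le)
                  qed
                  then have "par u \<in> ch g" using pu gr by (simp add: ch_def)
                  then have "par u = p" using chg by blast
                  then have "u \<in> ch p" using u by (simp add: ch_def)
                  then show ?thesis using chp by blast
                qed
                then show ?thesis using v p rV by blast
              qed
              moreover have "tree_type (insert v (insert p {r})) ?E"
                using tree_type_chain2[OF path_shape_1_small shape_singleton, of "{}" ?E r r p v]
                  Epv Egp gr v p pv by auto
              ultimately show ?thesis by simp
            next
              case gr: False
              define h where "h = par g"
              have g: "g \<in> V - {r}" using gV gr by blast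
              have hV: "h \<in> V" and dg: "d g = Suc (d h)"
                using par[OF g] d[OF g] by (simp_all add: h_def)
              have hne: "h \<noteq> g" "h \<noteq> p" "h \<noteq> v" using dg dp dv by auto
              have Ehg: "(h, g) \<in> ?E" using tree_edgesI[OF g, of par] by (simp add: h_def)
              have V3: "insert v (insert p (insert g (V - {g, p, v}))) = V" using v p g by blast
              have closed3: "u \<in> {g, p, v}" if "u \<in> V - {r}" "par u \<in> {g, p, v}" for u
                using that chp chv chg unfolding ch_def by blast
              have "tree_type (V - {g, p, v}) (tree_edges (V - {g, p, v}) r par)"
                using pr gr v closed3 p by (intro IH[of _ p]) auto
              then have "tree_type (insert v (insert p (insert g (V - {g, p, v})))) ?E"
                using fin sub[of "{g, p, v}"] hV hne gp gv pv Ehg Egp Epv sym_tree_edges[of V r par]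
                by (intro tree_type_chain3[of "V - {g, p, v}"
                  "tree_edges (V - {g, p, v}) r par" _ h]) auto
              then show ?thesis unfolding V3 .
            qed
          qed
        qed
      qed
    qed
  qed
qed

section \<open>Isomorphism with the extremal families\<close>

definition leg_rel :: "nat \<Rightarrow> leg_vertex rel \<Rightarrow> leg_vertex rel" where
  "leg_rel k H = H \<union> (\<Union>i\<in>{1..k}. {(A i, B i), (B i, A i), (B i, L i), (L i, B i)})"

definition star_hub :: "nat \<Rightarrow> leg_vertex rel" where
  "star_hub k = (\<Union>i\<in>{1..k}. {(C, A i), (A i, C)})"

primrec leg_code :: "leg_vertex \<Rightarrow> nat \<times> nat" where
  "leg_code C = T_center"
| "leg_code (A i) = (i, 1)"
| "leg_code (B i) = (i, 2)"
| "leg_code (L i) = (i, 3)"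

lemma inj_leg_code: "inj leg_code"
proof (rule injI)
  fix x y assume "leg_code x = leg_code y"
  then show "x = y" by (cases x; cases y) (auto simp: T_center_def)
qed

lemma leg_code_verts: "pverts (T_graph k) = leg_code ` leg_verts k"
proof -
  have "{1..3} = {1, 2, 3::nat}" by auto
  then show ?thesis
    unfolding T_graph_def leg_verts_def image_insert image_Un image_image leg_code.simps by auto
qed

lemma leg_code_arcs: "parcs (T_graph k) = map_prod leg_code leg_code ` leg_rel k (star_hub k)"
proof -
  have "parcs (T_graph k) = (\<Union>i\<in>{1..k}. {(T_center, (i, 1)), ((i, 1), (i, 2)), ((i, 2), (i, 3)),
      ((i, 1), T_center), ((i, 2), (i, 1)), ((i, 3), (i, 2))})"
    unfolding T_graph_def T_arcs_def by auto
  also have "\<dots> = map_prod leg_code leg_code ` leg_rel k (star_hub k)"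
    unfolding leg_rel_def star_hub_def image_Un image_UN
      by (simp add: UN_Un_distrib[symmetric] insert_commute)
  finally show ?thesis .
qed

lemma T_center_arc_iff: "(T_center, x) \<in> parcs (T_graph k) \<longleftrightarrow> (\<exists>i\<in>{1..k}. x = leg_code (A i))"
  unfolding T_graph_def T_arcs_def by (auto simp: T_center_def)

definition iso_legs :: "'a pair_pre_digraph \<Rightarrow> nat \<Rightarrow> leg_vertex rel \<Rightarrow> bool" where
  "iso_legs G k H \<longleftrightarrow> (\<exists>f. bij_betw f (leg_verts k) (pverts G) \<and>
      parcs G = map_prod f f ` leg_rel k H)"

text \<open>An arc of a pair digraph is the pair of its ends, so the vertex map forces the arc map
  of an isomorphism to be \<open>map_prod g g\<close>.\<close>

lemma digraph_iso_pair_iff: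
  assumes "pair_wf_digraph G"
  shows "digraph_iso (with_proj G) (with_proj X) \<longleftrightarrow>
    (\<exists>g. bij_betw g (pverts G) (pverts X) \<and> parcs X = map_prod g g ` parcs G)"
proof
  assume "digraph_iso (with_proj G) (with_proj X)"
  then obtain h where h: "pre_digraph.digraph_isomorphism (with_proj G) h"
    "with_proj X = app_iso h (with_proj G)"
    unfolding digraph_iso_def by blast
  have fs: "fst = iso_tail h" "snd = iso_head h" "pverts X = iso_verts h ` pverts G"
    "parcs X = iso_arcs h ` parcs G"
    using h(2) by (simp_all add: app_iso_def with_proj_def)
  have "iso_arcs h a = map_prod (iso_verts h) (iso_verts h) a" if "a \<in> parcs G" for a
    using h(1) that unfolding pre_digraph.digraph_isomorphism_def
    by (auto simp: fs(1,2)[symmetric] prod_eq_iff)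
  then have "parcs X = map_prod (iso_verts h) (iso_verts h) ` parcs G"
    unfolding fs(4) by (intro image_cong) auto
  moreover have "bij_betw (iso_verts h) (pverts G) (pverts X)"
    using h(1) fs(3) unfolding pre_digraph.digraph_isomorphism_def by (simp add: bij_betw_def)
  ultimately show "\<exists>g. bij_betw g (pverts G) (pverts X) \<and> parcs X = map_prod g g ` parcs G" by blast
next
  assume "\<exists>g. bij_betw g (pverts G) (pverts X) \<and> parcs X = map_prod g g ` parcs G"
  then obtain g where g: "bij_betw g (pverts G) (pverts X)" "parcs X = map_prod g g ` parcs G"
    by blast
  interpret pair_wf_digraph G by fact
  let ?h = "\<lparr>iso_verts = g, iso_arcs = map_prod g g, iso_head = snd, iso_tail = fst\<rparr>"
  have wf: "wf_digraph (with_proj G)" by unfold_locales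
  have inj: "inj_on g (pverts G)" using g by (simp add: bij_betw_def)
  have "inj_on (map_prod g g) (parcs G)"
  proof (rule inj_onI)
    fix a b assume "a \<in> parcs G" "b \<in> parcs G" "map_prod g g a = map_prod g g b"
    then show "a = b" using inj arc_fst_in_verts arc_snd_in_verts
      by (auto simp: prod_eq_iff dest: inj_onD)
  qed
  then have "pre_digraph.digraph_isomorphism (with_proj G) ?h"
    unfolding pre_digraph.digraph_isomorphism_def using wf inj by simp
  moreover have "with_proj X = app_iso ?h (with_proj G)"
    using g by (simp add: app_iso_def with_proj_def bij_betw_def)
  ultimately show "digraph_iso (with_proj G) (with_proj X)" unfolding digraph_iso_def by blast
qed

text \<open>Both directions compose with \<open>leg_code\<close> and an inverse on the vertex set.
  Membership in the families thereby becomes a statement about hubs.\<close>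

lemma digraph_iso_legs_iff:
  assumes G: "pair_wf_digraph G" and H: "H \<subseteq> hub k \<times> hub k"
    and X: "pverts X = leg_code ` leg_verts k" "parcs X = map_prod leg_code leg_code ` leg_rel k H"
  shows "digraph_iso (with_proj G) (with_proj X) \<longleftrightarrow> iso_legs G k H"
  unfolding digraph_iso_pair_iff[OF G]
proof
  interpret pair_wf_digraph G by fact
  have W: "leg_rel k H \<subseteq> leg_verts k \<times> leg_verts k"
    using H unfolding leg_rel_def leg_verts_def hub_def by auto
  have code: "bij_betw leg_code (leg_verts k) (pverts X)"
    unfolding X using inj_on_subset[OF inj_leg_code subset_UNIV] by (simp add: bij_betw_def)
  {
    assume "\<exists>g. bij_betw g (pverts G) (pverts X) \<and> parcs X = map_prod g g ` parcs G"
    then obtain g where g: "bij_betw g (pverts G) (pverts X)" "parcs X = map_prod g g ` parcs G"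
      by blast
    let ?f = "inv_into (pverts G) g \<circ> leg_code"
    have inv: "inv_into (pverts G) g (g x) = x" if "x \<in> pverts G" for x
      using g(1) that by (simp add: bij_betw_def)
    have "bij_betw ?f (leg_verts k) (pverts G)"
      using code g(1) by (intro bij_betw_trans[OF _ bij_betw_inv_into]) auto
    moreover have "map_prod ?f ?f ` leg_rel k H = parcs G"
    proof -
      have "map_prod ?f ?f ` leg_rel k H
          = map_prod (inv_into (pverts G) g) (inv_into (pverts G) g) ` parcs X"
        unfolding X(2) image_image by (intro image_cong) auto
      also have "\<dots> = id ` parcs G" unfolding g(2) image_image
        using inv wellformed' by (intro image_cong) auto
      finally show ?thesis by simp
    qed
    ultimately show "iso_legs G k H" unfolding iso_legs_def by metis
  }
  {
    assume "iso_legs G k H"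
    then obtain f where f: "bij_betw f (leg_verts k) (pverts G)"
      "parcs G = map_prod f f ` leg_rel k H"
      unfolding iso_legs_def by blast
    let ?g = "leg_code \<circ> inv_into (leg_verts k) f"
    have inv: "inv_into (leg_verts k) f (f x) = x" if "x \<in> leg_verts k" for x
      using f(1) that by (simp add: bij_betw_def)
    have "bij_betw ?g (pverts G) (pverts X)"
      using code f(1) by (intro bij_betw_trans[OF bij_betw_inv_into]) auto
    moreover have "map_prod ?g ?g ` parcs G = parcs X"
      unfolding f(2) X(2) image_image using inv W by (intro image_cong) auto
    ultimately show "\<exists>g. bij_betw g (pverts G) (pverts X) \<and> parcs X = map_prod g g ` parcs G"
      by metis
  }
qed

definition G_hub :: "nat \<Rightarrow> nat \<Rightarrow> nat \<Rightarrow> leg_vertex rel" where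
  "G_hub k u w = star_hub k \<union> {(A u, A w), (A w, A u)}"

definition F_hub :: "nat \<Rightarrow> nat \<Rightarrow> nat \<Rightarrow> leg_vertex rel" where
  "F_hub k u w = star_hub k - {(A u, C), (C, A u)} \<union> {(A u, A w), (A w, A u)}"

lemma hub_subsets:
  "star_hub k \<subseteq> hub k \<times> hub k"
  "u \<in> {1..k} \<Longrightarrow> w \<in> {1..k} \<Longrightarrow> G_hub k u w \<subseteq> hub k \<times> hub k"
  "u \<in> {1..k} \<Longrightarrow> w \<in> {1..k} \<Longrightarrow> F_hub k u w \<subseteq> hub k \<times> hub k"
  unfolding star_hub_def G_hub_def F_hub_def hub_def by auto

lemma family_T_iff:
  assumes "pair_wf_digraph G"
  shows "G \<in> family_T \<longleftrightarrow> (\<exists>k\<ge>1. iso_legs G k (star_hub k))"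
  unfolding family_T_def
  using digraph_iso_legs_iff[OF assms hub_subsets(1) leg_code_verts leg_code_arcs] by simp

lemma inj_map_prod_leg_code: "inj (map_prod leg_code leg_code)"
  using inj_leg_code by (simp add: prod.inj_map)

lemma ex_leg_code_pair_iff:
  "(\<exists>u w. u \<noteq> w \<and> (\<exists>i\<in>I. u = leg_code (A i)) \<and> (\<exists>j\<in>I. w = leg_code (A j)) \<and> P u w) \<longleftrightarrow>
    (\<exists>i\<in>I. \<exists>j\<in>I. i \<noteq> j \<and> P (leg_code (A i)) (leg_code (A j)))"
  (is "?L \<longleftrightarrow> ?R")
proof
  assume ?L
  then obtain u w i j where *: "u \<noteq> w" "i \<in> I" "u = leg_code (A i)" "j \<in> I" "w = leg_code (A j)"
    "P u w"
    by (elim exE conjE bexE)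
  then have "i \<noteq> j" by auto
  then show ?R using *(2,4,6) unfolding *(3,5) by (intro bexI conjI)
next
  assume ?R
  then obtain i j where *: "i \<in> I" "j \<in> I" "i \<noteq> j" "P (leg_code (A i)) (leg_code (A j))"
    by (elim bexE conjE)
  then have "leg_code (A i) \<noteq> leg_code (A j)" by simp
  then show ?L
    using * by (intro exI[of _ "leg_code (A i)"] exI[of _
      "leg_code (A j)"] conjI bexI[of _ i] bexI[of _ j]) simp_all
qed

lemma family_G_iff:
  assumes "pair_wf_digraph G"
  shows "G \<in> family_G \<longleftrightarrow> (\<exists>k\<ge>2. \<exists>u\<in>{1..k}. \<exists>w\<in>{1..k}. u \<noteq> w \<and> iso_legs G k (G_hub k u w))"
proof -
  have "digraph_iso (with_proj G)
        (with_proj (add_edge (T_graph k) (leg_code (A u)) (leg_code (A w))))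
      \<longleftrightarrow> iso_legs G k (G_hub k u w)" if "u \<in> {1..k}" "w \<in> {1..k}" for k u w
  proof (rule digraph_iso_legs_iff[OF assms hub_subsets(2)[OF that]])
    show "parcs (add_edge (T_graph k) (leg_code (A u)) (leg_code (A w))) =
        map_prod leg_code leg_code ` leg_rel k (G_hub k u w)"
      unfolding add_edge_def G_hub_def by (simp add: leg_code_arcs leg_rel_def image_Un Un_ac)
  qed (simp add: add_edge_def leg_code_verts)
  then show ?thesis unfolding family_G_def T_center_arc_iff mem_Collect_eq ex_leg_code_pair_iff
    by (intro arg_cong[where f = Ex] ext conj_cong bex_cong refl)
qed

lemma family_F_iff:
  assumes "pair_wf_digraph G"
  shows "G \<in> family_F \<longleftrightarrow> (\<exists>k\<ge>2. \<exists>u\<in>{1..k}. \<exists>w\<in>{1..k}. u \<noteq> w \<and> iso_legs G k (F_hub k u w))"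
proof -
  have "digraph_iso (with_proj G)
        (with_proj (add_edge (del_edge (T_graph k) (leg_code (A u)) T_center)
          (leg_code (A u)) (leg_code (A w)))) \<longleftrightarrow> iso_legs G k (F_hub k u w)"
    if "u \<in> {1..k}" "w \<in> {1..k}" for k u w
  proof (rule digraph_iso_legs_iff[OF assms hub_subsets(3)[OF that]])
    have "leg_rel k (F_hub k u w) = leg_rel k (star_hub k) - {(A u, C), (C, A u)} \<union>
        {(A u, A w), (A w, A u)}"
      unfolding leg_rel_def F_hub_def by auto
    then show "parcs (add_edge (del_edge (T_graph k) (leg_code (A u)) T_center)
          (leg_code (A u)) (leg_code (A w))) =
        map_prod leg_code leg_code ` leg_rel k (F_hub k u w)"
      unfolding add_edge_def del_edge_def
      by (simp add: leg_code_arcs image_Un image_set_diff[OF inj_map_prod_leg_code])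
  qed (simp add: add_edge_def del_edge_def leg_code_verts)
  then show ?thesis unfolding family_F_def T_center_arc_iff mem_Collect_eq ex_leg_code_pair_iff
    by (intro arg_cong[where f = Ex] ext conj_cong bex_cong refl)
qed

text \<open>\<open>HA\<close> treats all three families at once: among the \<open>A i\<close>, at
  most \<open>A u\<close> and \<open>A w\<close> are adjacent. The leaf \<open>L i\<close> forces
  \<open>B i\<close>, and a second vertex for each leg is found by charging.\<close>

lemma card_dom_set_leg_rel:
  assumes S: "dom_set (leg_verts k) (leg_rel k H) S"
    and H: "H \<subseteq> hub k \<times> hub k"
    and HA: "\<And>i x. (A i, x) \<in> H \<Longrightarrow> x = C \<or> (i = u \<and> x = A w) \<or> (i = w \<and> x = A u)"
  shows "2 * k \<le> card S"
proof -
  let ?R = "leg_rel k H"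
  have nL: "s = B i" if "(L i, s) \<in> ?R" for i s
    using that H by (auto simp: leg_rel_def hub_def)
  have nB: "s = L i \<or> s = A i" if "(B i, s) \<in> ?R" for i s
    using that H by (auto simp: leg_rel_def hub_def)
  have nA: "s = B i \<or> s = C \<or> (i = u \<and> s = A w) \<or> (i = w \<and> s = A u)" if "(A i, s) \<in> ?R" for i s
    using that HA by (auto simp: leg_rel_def)
  have fin: "finite S"
    using S finite_subset[of S "leg_verts k"] by (simp add: dom_set_def leg_verts_def)
  have BS: "B i \<in> S" if "i \<in> {1..k}" for i
    using leaf_support_in_dom_set[OF S _ nL nB, of i] that by (simp add: leg_verts_def)
  \<comment> \<open>Besides \<open>B i\<close>, leg \<open>i\<close> is charged \<open>g i\<close>; at most one leg is charged \<open>C\<close>.\<close>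
  define g where "g i = (if A i \<in> S then A i else if L i \<in> S then L i else C)" for i
  \<comment> \<open>Here \<open>B i\<close> can only be served at two steps through
    \<open>A i\<close>, where \<open>C\<close> and the partner in the pair are the only candidates.
    So both lie in \<open>S\<close>, and the leg of the partner is not poor.\<close>
  have poor: "C \<in> S \<and> (i = u \<and> A w \<in> S \<or> i = w \<and> A u \<in> S)"
    if i: "i \<in> {1..k}" "A i \<notin> S" "L i \<notin> S" for i
  proof -
    have "served ?R S (B i)" using S i by (simp add: dom_set_def leg_verts_def)
    moreover have "\<not> (\<exists>s\<in>S. (B i, s) \<in> ?R)" using nB i by blast
    ultimately obtain s t a b where st: "s \<in> S" "t \<in> S" "s \<noteq> t" "s \<noteq> B i" "t \<noteq> B i"
        "(B i, a) \<in> ?R" "(a, s) \<in> ?R" "(B i, b) \<in> ?R" "(b, t) \<in> ?R"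
      unfolding served_def by blast
    have "a = A i" "b = A i" using nB[OF st(6)] nB[OF st(8)] nL[of i s] nL[of i t] st by auto
    then show ?thesis using nA[of i s] nA[of i t] st by auto
  qed
  have "inj_on g {1..k}"
  proof (rule inj_onI)
    fix i j assume ij: "i \<in> {1..k}" "j \<in> {1..k}" "g i = g j"
    show "i = j"
    proof (cases "g i = C")
      case True
      then have "A i \<notin> S" "L i \<notin> S" "A j \<notin> S" "L j \<notin> S"
        using ij(3) by (auto simp: g_def split: if_splits)
      then show ?thesis using poor[OF ij(1)] poor[OF ij(2)] by auto
    next
      case False
      then show ?thesis using ij(3) by (auto simp: g_def split: if_splits)
    qed
  qed
  then have "card (g ` {1..k}) = k" by (simp add: card_image)
  moreover have "card (B ` {1..k}) = k" by (simp add: card_image inj_on_def)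
  moreover have "g ` {1..k} \<inter> B ` {1..k} = {}" by (auto simp: g_def split: if_splits)
  ultimately have "card (g ` {1..k} \<union> B ` {1..k}) = 2 * k" by (simp add: card_Un_disjoint)
  moreover have "g ` {1..k} \<union> B ` {1..k} \<subseteq> S" using BS poor by (auto simp: g_def)
  ultimately show ?thesis using card_mono[OF fin] by metis
qed

text \<open>The inverse of the isomorphism embeds \<open>G\<close> onto the leg graph, so dominating
  sets of \<open>G\<close> can be counted there.\<close>

lemma card_dom_set_iso_legs:
  assumes "iso_legs G k H" "dom_set (pverts G) (parcs G) S" "parcs G \<subseteq> pverts G \<times> pverts G"
    and H: "H \<subseteq> hub k \<times> hub k"
    and HA: "\<And>i x. (A i, x) \<in> H \<Longrightarrow> x = C \<or> (i = u \<and> x = A w) \<or> (i = w \<and> x = A u)"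
  shows "2 * k \<le> card S" "card (pverts G) = 3 * k + 1"
proof -
  obtain f where f: "bij_betw f (leg_verts k) (pverts G)" "parcs G = map_prod f f ` leg_rel k H"
    using assms(1) unfolding iso_legs_def by blast
  have W: "leg_rel k H \<subseteq> leg_verts k \<times> leg_verts k"
    using H unfolding leg_rel_def leg_verts_def hub_def by auto
  let ?h = "inv_into (leg_verts k) f"
  have inv: "?h (f x) = x" if "x \<in> leg_verts k" for x
    using f(1) that by (simp add: bij_betw_def)
  have "emb ?h (pverts G) (parcs G) (leg_verts k) (leg_rel k H)"
    unfolding emb_def
  proof (intro conjI)
    show "bij_betw ?h (pverts G) (leg_verts k)" using f(1) by (rule bij_betw_inv_into)
    show "\<forall>(x, y)\<in>parcs G. (?h x, ?h y) \<in> leg_rel k H"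
    proof clarify
      fix x y assume "(x, y) \<in> parcs G"
      then obtain a b where ab: "(a, b) \<in> leg_rel k H" "x = f a" "y = f b" unfolding f(2) by auto
      then have "a \<in> leg_verts k" "b \<in> leg_verts k" using W by auto
      then show "(?h x, ?h y) \<in> leg_rel k H" using ab inv by simp
    qed
  qed fact
  note h = dom_set_emb[OF this assms(2)]
  have "2 * k \<le> card (?h ` S)" using h(1) H HA by (rule card_dom_set_leg_rel)
  then show "2 * k \<le> card S" unfolding h(2) .
  show "card (pverts G) = 3 * k + 1" using bij_betw_same_card[OF f(1)] card_leg_verts by simp
qed

lemma hub_A_nbr:
  "(A i, x) \<in> star_hub k \<Longrightarrow> x = C"
  "(A i, x) \<in> G_hub k u w \<Longrightarrow> x = C \<or> (i = u \<and> x = A w) \<or> (i = w \<and> x = A u)"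
  "(A i, x) \<in> F_hub k u w \<Longrightarrow> x = C \<or> (i = u \<and> x = A w) \<or> (i = w \<and> x = A u)"
  unfolding star_hub_def G_hub_def F_hub_def by auto

lemma (in pair_graph) family_card:
  assumes "G \<in> family_T \<union> family_F \<union> family_G" "dom_set (pverts G) (parcs G) S"
  shows "\<exists>k. card (pverts G) = 3 * k + 1 \<and> 2 * k \<le> card S"
proof -
  have wf: "pair_wf_digraph G" by unfold_locales
  have sub: "parcs G \<subseteq> pverts G \<times> pverts G" using wellformed' by auto
  note card = card_dom_set_iso_legs[OF _ assms(2) sub]
  from assms(1) consider "G \<in> family_T" | "G \<in> family_F" | "G \<in> family_G" by blast
  then show ?thesis
  proof cases
    case 1
    then obtain k where iso: "iso_legs G k (star_hub k)" using family_T_iff[OF wf] by blast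
    show ?thesis using card[OF iso hub_subsets(1)] hub_A_nbr(1) by blast
  next
    case 2
    then obtain k u w where uw: "u \<in> {1..k}" "w \<in> {1..k}" and iso: "iso_legs G k (F_hub k u w)"
      using family_F_iff[OF wf] by blast
    show ?thesis
      using card[OF iso hub_subsets(3)[OF uw], of u w] hub_A_nbr(3)[of _ _ k u w] by blast
  next
    case 3
    then obtain k u w where uw: "u \<in> {1..k}" "w \<in> {1..k}" and iso: "iso_legs G k (G_hub k u w)"
      using family_G_iff[OF wf] by blast
    show ?thesis
      using card[OF iso hub_subsets(2)[OF uw], of u w] hub_A_nbr(2)[of _ _ k u w] by blast
  qed
qed

section \<open>From sharp legs to the three families\<close>

context tight_legs
begin

lemma R_eq_leg_rel:
  assumes W: "R \<subseteq> leg_verts k \<times> leg_verts k" and irr: "\<And>x. (x, x) \<notin> R"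
  shows "R = leg_rel k (R \<inter> hub k \<times> hub k)"
proof
  show "leg_rel k (R \<inter> hub k \<times> hub k) \<subseteq> R" using leg by (auto simp: leg_rel_def)
  show "R \<subseteq> leg_rel k (R \<inter> hub k \<times> hub k)"
  proof (rule subrelI)
    fix x y assume xy: "(x, y) \<in> R"
    have V: "x \<in> leg_verts k" "y \<in> leg_verts k" and ne: "x \<noteq> y" using W irr xy by auto
    have *: "(x, y) \<in> leg_rel k (R \<inter> hub k \<times> hub k) \<and> (y, x) \<in> leg_rel k (R \<inter> hub k \<times> hub k)"
      if xy: "(x, y) \<in> R" and V: "x \<in> leg_verts k" "y \<in> leg_verts k" and ne: "x \<noteq> y" and "x \<notin> hub k"
        for x y
    proof (cases x)
      case (B i)
      then have i: "i \<in> {1..k}" using V by (auto simp: leg_verts_def)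
      then have "y = A i \<or> y = L i" using B_nbr xy V ne B by blast
      then show ?thesis using i B by (auto simp: leg_rel_def)
    next
      case (L i)
      then have i: "i \<in> {1..k}" using V by (auto simp: leg_verts_def)
      then have "y = B i" using L_nbr xy V ne L by blast
      then show ?thesis using i L by (auto simp: leg_rel_def)
    qed (use that in \<open>auto simp: leg_verts_def hub_def\<close>)
    show "(x, y) \<in> leg_rel k (R \<inter> hub k \<times> hub k)"
    proof (cases "x \<in> hub k \<and> y \<in> hub k")
      case True
      then show ?thesis using xy by (auto simp: leg_rel_def)
    next
      case False
      then show ?thesis using *[OF xy V ne] *[OF symR[OF xy] V(2,1) ne[symmetric]] by blast
    qed
  qed
qed

text \<open>Without a pair every \<open>A i\<close> meets \<open>C\<close>. With a pair all
  \<open>A m\<close> other than \<open>A u\<close> do, and the one undecided edge between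
  \<open>C\<close> and \<open>A u\<close> separates \<open>G_hub\<close> from
  \<open>F_hub\<close>.\<close>

lemma hub_types:
  assumes irr: "\<And>x. (x, x) \<notin> R"
  shows "R \<inter> hub k \<times> hub k = star_hub k \<or>
    (\<exists>u\<in>{1..k}. \<exists>w\<in>{1..k}. u \<noteq> w \<and>
      (R \<inter> hub k \<times> hub k = F_hub k u w \<or> R \<inter> hub k \<times> hub k = G_hub k u w))"
proof -
  have mem: "(x, y) \<in> R \<inter> hub k \<times> hub k \<longleftrightarrow>
      (\<exists>i\<in>{1..k}. (x = C \<and> y = A i \<or> x = A i \<and> y = C) \<and> (C, A i) \<in> R) \<or>
      (\<exists>i j. x = A i \<and> y = A j \<and> adj i j)" for x y
  proof -
    have "(A i, C) \<in> R \<longleftrightarrow> (C, A i) \<in> R" for i using symR by blast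
    moreover have "(A i, A j) \<in> R \<longleftrightarrow> adj i j" if "i \<in> {1..k}" "j \<in> {1..k}" for i j
      using that irr by (auto simp: adj_def)
    moreover have "adj i j \<Longrightarrow> i \<in> {1..k} \<and> j \<in> {1..k}" for i j using adjD(3,4) by blast
    ultimately show ?thesis using irr
      by (cases x; cases y) (auto simp: hub_def)
  qed
  show ?thesis
  proof (cases rule: hub_cases)
    case star
    then have "(C, A i) \<in> R" if "i \<in> {1..k}" for i using cut_AC that by blast
    note all = this
    have "R \<inter> hub k \<times> hub k = star_hub k"
    proof (rule set_eqI, clarify)
      fix x y
      show "(x, y) \<in> R \<inter> hub k \<times> hub k \<longleftrightarrow> (x, y) \<in> star_hub k"
        unfolding mem star_hub_def using all star by auto
    qed
    then show ?thesis ..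
  next
    case (pair w u)
    note wu = adjD[OF pair(1)]
    have adj: "adj i j \<longleftrightarrow> i = w \<and> j = u \<or> i = u \<and> j = w" for i j
      using adj_only_pair[OF pair(1)] pair(1) adj_sym[OF pair(1)] by blast
    have Cm: "(C, A m) \<in> R" if "m \<in> {1..k}" "m \<noteq> u" for m
      using pair(2) cut_AC[OF that(1) not_adj_outside_pair[OF pair(1) _ that(2)]] by blast
    show ?thesis
    proof (cases "(C, A u) \<in> R")
      case True
      then have Call: "(C, A m) \<in> R" if "m \<in> {1..k}" for m using Cm[OF that] by (cases "m = u") auto
      have "R \<inter> hub k \<times> hub k = G_hub k u w"
      proof (rule set_eqI, clarify)
        fix x y
        show "(x, y) \<in> R \<inter> hub k \<times> hub k \<longleftrightarrow> (x, y) \<in> G_hub k u w"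
          unfolding mem adj G_hub_def star_hub_def using Call by auto
      qed
      then show ?thesis using wu by metis
    next
      case False
      have "R \<inter> hub k \<times> hub k = F_hub k u w"
      proof (rule set_eqI, clarify)
        fix x y
        show "(x, y) \<in> R \<inter> hub k \<times> hub k \<longleftrightarrow> (x, y) \<in> F_hub k u w"
          unfolding mem adj F_hub_def star_hub_def using Cm False by auto
      qed
      then show ?thesis using wu by metis
    qed
  qed
qed

end

lemma (in pair_graph) legged_in_family:
  assumes "legged (pverts G) (parcs G)" "8 \<le> card (pverts G)" "\<not> dom_strict (pverts G) (parcs G)"
  shows "G \<in> family_T \<union> family_F \<union> family_G"
proof -
  have wf: "pair_wf_digraph G" by unfold_locales
  obtain k R f where "legs k R" and f: "emb f (leg_verts k) R (pverts G) (parcs G)"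
    using assms(1) by (auto simp: legged_def)
  interpret legs k R by fact
  have bij: "bij_betw f (leg_verts k) (pverts G)" using f by (simp add: emb_def)
  \<comment> \<open>Two legs give only 7 vertices.\<close>
  have k: "3 \<le> k" using bij_betw_same_card[OF bij] assms(2) by (simp add: card_leg_verts)
  \<comment> \<open>\<open>R\<close> need not contain all edges of \<open>G\<close>. The exclusions
    must see every edge, so they are applied to the full pull-back \<open>Q\<close>.\<close>
  define Q where "Q = {(x, y) \<in> leg_verts k \<times> leg_verts k. (f x, f y) \<in> parcs G}"
  have embQ: "emb f (leg_verts k) Q (pverts G) (parcs G)" using bij by (auto simp: emb_def Q_def)
  have RQ: "R \<subseteq> Q" using f by (auto simp: emb_def Q_def)
  have symG: "(y, x) \<in> parcs G" if "(x, y) \<in> parcs G" for x y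
    using pair_sym_arcs that by (auto simp: symmetric_def dest: symD)
  interpret Q: tight_legs k Q
  proof
    show "(y, x) \<in> Q" if "(x, y) \<in> Q" for x y using that symG by (auto simp: Q_def)
    show "(A i, B i) \<in> Q" "(B i, L i) \<in> Q" if "i \<in> {1..k}" for i using AB BL RQ that by blast+
    show "\<exists>x\<in>U. \<exists>y\<in>hub k - U. (x, y) \<in> Q" if "C \<in> U" "U \<subset> hub k" for U
      using cut[OF that] RQ by blast
    show "3 \<le> k" by (rule k)
    show "\<not> dom_strict (leg_verts k) Q" using dom_strict_emb[OF embQ] assms(3) by blast
  qed
  have irr: "(x, x) \<notin> Q" for x using pair_no_loops[of "(f x, f x)"] by (auto simp: Q_def)
  have W: "Q \<subseteq> leg_verts k \<times> leg_verts k" by (auto simp: Q_def)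
  have "parcs G = map_prod f f ` Q"
  proof
    show "map_prod f f ` Q \<subseteq> parcs G" by (auto simp: Q_def)
    show "parcs G \<subseteq> map_prod f f ` Q"
    proof (rule subrelI)
      fix x y assume xy: "(x, y) \<in> parcs G"
      have "x \<in> f ` leg_verts k" "y \<in> f ` leg_verts k"
        using wellformed'[OF xy] bij by (simp_all add: bij_betw_def)
      then obtain a b where ab: "a \<in> leg_verts k" "b \<in> leg_verts k" "x = f a" "y = f b" by blast
      then have "(a, b) \<in> Q" using xy by (simp add: Q_def)
      then show "(x, y) \<in> map_prod f f ` Q" unfolding ab(3,4) by (metis imageI map_prod_simp)
    qed
  qed
  then have iso: "iso_legs G k (Q \<inter> hub k \<times> hub k)"
    unfolding iso_legs_def using bij Q.R_eq_leg_rel[OF W irr] by auto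
  from Q.hub_types[OF irr] consider "iso_legs G k (star_hub k)"
    | u w where "u \<in> {1..k}" "w \<in> {1..k}" "u \<noteq> w" "iso_legs G k (F_hub k u w)"
    | u w where "u \<in> {1..k}" "w \<in> {1..k}" "u \<noteq> w" "iso_legs G k (G_hub k u w)"
    using iso by metis
  then show ?thesis
  proof cases
    case 1
    moreover have "1 \<le> k" using k by simp
    ultimately show ?thesis using family_T_iff[OF wf] by blast
  next
    case (2 u w)
    moreover have "2 \<le> k" using k by simp
    ultimately show ?thesis using family_F_iff[OF wf] by blast
  next
    case (3 u w)
    moreover have "2 \<le> k" using k by simp
    ultimately show ?thesis using family_G_iff[OF wf] by blast
  qed
qed

text \<open>A breadth-first tree: \<open>d\<close> is the least length of a walk from
  \<open>r\<close>, and the parent is a neighbour one layer closer.\<close>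

lemma (in pair_graph) spanning_rtree:
  assumes "Digraph_Component.connected (with_proj G)"
  obtains r par d where "rtree (pverts G) r par d" "tree_edges (pverts G) r par \<subseteq> parcs G"
proof -
  let ?V = "pverts G" and ?E = "parcs G"
  have symG: "(y, x) \<in> ?E" if "(x, y) \<in> ?E" for x y
    using pair_sym_arcs that by (auto simp: symmetric_def dest: symD)
  have symcl: "?E\<^sup>s = ?E" using symG by (auto simp: symcl_def)
  obtain r where r: "r \<in> ?V" and reach: "\<And>v. v \<in> ?V \<Longrightarrow> (r, v) \<in> rtrancl_on ?V ?E"
    using assms unfolding connected_conv by (auto simp: symcl)
  have ex: "\<exists>n. (r, v) \<in> ?E ^^ n" if "v \<in> ?V" for v
    using reach[OF that]
  proof (induction rule: rtrancl_on_induct)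
    case base
    show ?case by (intro exI[of _ 0]) simp
  next
    case (step y z)
    then obtain n where "(r, y) \<in> ?E ^^ n" by blast
    then show ?case using step by (intro exI[of _ "Suc n"]) auto
  qed
  define d where "d v = (LEAST n. (r, v) \<in> ?E ^^ n)" for v
  have d: "(r, v) \<in> ?E ^^ d v" if "v \<in> ?V" for v
    unfolding d_def using ex[OF that] by (rule LeastI_ex)
  have d_le: "d v \<le> n" if "(r, v) \<in> ?E ^^ n" for v n
    unfolding d_def using that by (rule Least_le)
  have par: "\<exists>u. (u, v) \<in> ?E \<and> d v = Suc (d u)" if v: "v \<in> ?V - {r}" for v
  proof -
    have rv: "(r, v) \<in> ?E ^^ d v" using d v by blast
    then obtain m where m: "d v = Suc m" using v by (cases "d v") auto
    then obtain u where u: "(r, u) \<in> ?E ^^ m" "(u, v) \<in> ?E" using rv by auto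
    have "u \<in> ?V" using wellformed'[OF u(2)] by blast
    then have "(r, v) \<in> ?E ^^ Suc (d u)" using d[of u] u(2) by auto
    then have "Suc m \<le> Suc (d u)" using d_le m by metis
    then have "d u = m" using d_le[OF u(1)] by simp
    then show ?thesis using m u(2) by blast
  qed
  define par where "par v = (SOME u. (u, v) \<in> ?E \<and> d v = Suc (d u))" for v
  have p: "(par v, v) \<in> ?E" "d v = Suc (d (par v))" if "v \<in> ?V - {r}" for v
    using someI_ex[OF par[OF that]] unfolding par_def by blast+
  have "rtree ?V r par d"
    unfolding rtree_def using pair_finite_verts r p wellformed' by blast
  moreover have "tree_edges ?V r par \<subseteq> ?E"
    unfolding tree_edges_def using p(1) symG by blast
  ultimately show ?thesis by (rule that)
qed

lemma shape_card: "shape V E Y \<Longrightarrow> card V = fst Y"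
  unfolding shape_def emb_def by (metis bij_betw_same_card card_lessThan)

theorem mainTheorem1:
  fixes G :: "'a pair_pre_digraph"
  assumes "pair_graph G"
    and "Digraph_Component.connected (with_proj G)"
    and "card (pverts G) \<ge> 8"
  shows "real (dtd_number G) \<le> 2 * (real (card (pverts G)) - 1) / 3 \<and>
         (real (dtd_number G) = 2 * (real (card (pverts G)) - 1) / 3 \<longleftrightarrow>
            G \<in> family_T \<union> family_F \<union> family_G)"
proof -
  interpret pair_graph G by fact
  let ?V = "pverts G" and ?E = "parcs G"
  obtain r par d where tree: "rtree ?V r par d" "tree_edges ?V r par \<subseteq> ?E"
    using spanning_rtree[OF assms(2)] .
  have type: "tree_type ?V ?E" by (rule tree_type_mono[OF tree_type_rtree[OF tree(1)] tree(2)])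
  have "\<forall>Y\<in>set (take 8 small_shapes). fst Y \<le> 7"
    by (simp add: small_shapes_def path_shape_def pendant_shape_def)
  then have no_shape: "\<not> (\<exists>Y\<in>set (take 8 small_shapes). shape ?V ?E Y)"
    using shape_card assms(3) by fastforce
  moreover have "set (take 5 small_shapes) \<subseteq> set (take 8 small_shapes)"
    by (rule set_take_subset_set_take) simp
  ultimately have "dom_weak ?V ?E" using tree_type_cases[OF type] by blast
  then obtain S0 where S0: "dom_set ?V ?E S0" "3 * card S0 + 2 \<le> 2 * card ?V"
    by (auto simp: dom_weak_def)
  have number: "dtd_number G = (LEAST m. \<exists>S. dom_set ?V ?E S \<and> card S = m)"
    unfolding dtd_number_def dtd_set_iff_dom_set ..
  have least: "dtd_number G \<le> card S" if "dom_set ?V ?E S" for S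
    unfolding number using that by (intro Least_le) blast
  obtain S1 where S1: "dom_set ?V ?E S1" "card S1 = dtd_number G"
    using LeastI[of "\<lambda>m. \<exists>S. dom_set ?V ?E S \<and> card S = m" "card S0"] S0(1)
    unfolding number by blast
  have upper: "3 * dtd_number G + 2 \<le> 2 * card ?V" using least[OF S0(1)] S0(2) by linarith
  have "3 * dtd_number G + 2 = 2 * card ?V \<longleftrightarrow> G \<in> family_T \<union> family_F \<union> family_G"
  proof
    assume eq: "3 * dtd_number G + 2 = 2 * card ?V"
    have "\<not> dom_strict ?V ?E"
    proof
      assume "dom_strict ?V ?E"
      then obtain S where "dom_set ?V ?E S" "3 * card S + 2 < 2 * card ?V"
        by (auto simp: dom_strict_def)
      then show False using least eq by fastforce
    qed
    moreover from this have "legged ?V ?E" using type no_shape by (auto simp: tree_type_def)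
    ultimately show "G \<in> family_T \<union> family_F \<union> family_G" using legged_in_family assms(3) by blast
  next
    assume "G \<in> family_T \<union> family_F \<union> family_G"
    \<comment> \<open>With \<open>3 * k + 1\<close> vertices, \<open>upper\<close> says that
      \<open>dtd_number G\<close> is at most \<open>2 * k\<close>, which the lower bound turns into
      equality.\<close>
    then obtain k where "card ?V = 3 * k + 1" "2 * k \<le> card S1"
      using family_card[OF _ S1(1)] by blast
    then show "3 * dtd_number G + 2 = 2 * card ?V" using upper S1(2) by simp
  qed
  moreover have
    "real (dtd_number G) = 2 * (real (card ?V) - 1) / 3 \<longleftrightarrow> 3 * dtd_number G + 2 = 2 * card ?V"
    by (simp add: field_simps flip: of_nat_eq_iff[where 'a = real])
  moreover have "real (dtd_number G) \<le> 2 * (real (card ?V) - 1) / 3"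
    using upper by (simp add: field_simps flip: of_nat_le_iff[where 'a = real])
  ultimately show ?thesis by blast
qed

end
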